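(* Let $\mathcal{C}_{\mathrm{Q\text{-}reg}}$ (respectively $\mathcal{C}_{\mathrm{reg}}$) be the largest constant $\mathcal{C}$ such that $\mathrm{SPA}_{\oplus1}(F_1,\dots,F_n)\ge\mathcal{C}\cdot\mathrm{BOM}(F_1,\dots,F_n)$ for every $n\ge1$ and all quasi-regular (respectively, all regular) distributions $F_1,\dots,F_n$ (buyers with independent, not necessarily identically distributed values). Then $\mathcal{C}_{\mathrm{Q\text{-}reg}}\in[0.2770,\,0.6365]$ and $\mathcal{C}_{\mathrm{reg}}\in[0.3817,\,0.6365]$.
   Context: A seller sells a single item to $n$ buyers with independent values $v_i\sim F_i$. Numerical constants are rounded to four decimal digits. Distributions are on $[0,\infty)$ (atoms allowed), identified with their CDF $F(v)=\Pr[V\le v]$; monotonicity conditions are required on the whole interval from $0$ to the supremum of the possible values. $F$ is quasi-regular if $v\mapsto -v\cdot\frac{1-F(v)}{F(v)}$ is weakly increasing over $v$ with $F(v)>0$. $F$ is regular if $v-\frac{1-F(v)}{F'(v)}$ is weakly increasing; equivalently (and this is the meaning in the absence of a density) the revenue curve $R(q)=q\cdot\sup\{v:F(v)\le1-q\}$, $q\in(0,1]$, is concave. $\mathrm{SPA}_{\oplus1}(F_1,\dots,F_n)$ ($1$-Duplicate Second Price Auction) is $\max_{i\in[n]}$ of the expected second highest value among $n+1$ independent values from $F_1,\dots,F_n,F_i$ (the revenue of the second price auction without reserve after one optimally chosen buyer $i$ is duplicated). $\mathrm{BOM}$ (Bayesian Optimal Mechanism, i.e. Myerson's auction, on the original $n$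 buyers without duplicates) is the optimal (supremum) expected revenue $\mathbb{E}[\sum_i p_i(v)]$ over all dominant-strategy incentive-compatible and individually rational mechanisms, i.e. allocation rules $x_i(v)\in[0,1]$ with $\sum_ix_i(v)\le1$ and payments $p_i(v)\ge0$, where buyer $i$'s utility is $v_ix_i-p_i$. *)

theory Defs
  imports "HOL-Probability.Probability"
begin

definition value_dist :: "real measure \<Rightarrow> bool" where
  "value_dist D \<longleftrightarrow> real_distribution D \<and> (AE v in D. 0 \<le> v)"

definition quasi_regular :: "real measure \<Rightarrow> bool" where
  "quasi_regular D \<longleftrightarrow>
     mono_on {v. 0 < cdf D v} (\<lambda>v. - v * ((1 - cdf D v) / cdf D v))"

(* The supremum ranges over all reals: cdf D v = 0 for v < 0, so for 0 < q \<le> 1 the set is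
   nonempty even when D has an atom at 0, and it is bounded above because cdf D tends to 1. *)
definition revenue_curve :: "real measure \<Rightarrow> real \<Rightarrow> real" where
  "revenue_curve D q = q * Sup {v. cdf D v \<le> 1 - q}"

definition regular :: "real measure \<Rightarrow> bool" where
  "regular D \<longleftrightarrow> concave_on {0<..1} (revenue_curve D)"

text \<open>The buyers are \<open>0, \<dots>, n - 1\<close>; only \<open>F i\<close> with \<open>i < n\<close> matters.
  Expectations are taken in \<^typ>\<open>ennreal\<close>, so no integrability has to be assumed.\<close>

definition second_highest :: "nat \<Rightarrow> (nat \<Rightarrow> real) \<Rightarrow> real" where
  "second_highest m v = rev (sort (map v [0..<m])) ! 1"

definition SPA :: "nat \<Rightarrow> (nat \<Rightarrow> real measure) \<Rightarrow> ennreal" where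
  "SPA m F = (\<integral>\<^sup>+ v. ennreal (second_highest m v) \<partial>(\<Pi>\<^sub>M i\<in>{..<m}. F i))"

(* The independent copy of buyer i takes the new index n. *)
definition SPA_dup1 :: "nat \<Rightarrow> (nat \<Rightarrow> real measure) \<Rightarrow> ennreal" where
  "SPA_dup1 n F = Max ((\<lambda>i. SPA (Suc n) (F(n := F i))) ` {..<n})"

definition value_profiles :: "nat \<Rightarrow> (nat \<Rightarrow> real) set" where
  "value_profiles n = (\<Pi>\<^sub>E i\<in>{..<n}. {0..})"

definition feasible :: "nat \<Rightarrow> (nat \<Rightarrow> (nat \<Rightarrow> real) \<Rightarrow> real) \<Rightarrow> (nat \<Rightarrow> (nat \<Rightarrow> real) \<Rightarrow> real) \<Rightarrow> bool"
  where
  "feasible n x p \<longleftrightarrow>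
     (\<forall>i<n. x i \<in> borel_measurable (\<Pi>\<^sub>M i\<in>{..<n}. borel) \<and>
            p i \<in> borel_measurable (\<Pi>\<^sub>M i\<in>{..<n}. borel)) \<and>
     (\<forall>v\<in>value_profiles n.
        (\<forall>i<n. 0 \<le> x i v \<and> x i v \<le> 1 \<and> 0 \<le> p i v) \<and> (\<Sum>i<n. x i v) \<le> 1)"

definition DSIC :: "nat \<Rightarrow> (nat \<Rightarrow> (nat \<Rightarrow> real) \<Rightarrow> real) \<Rightarrow> (nat \<Rightarrow> (nat \<Rightarrow> real) \<Rightarrow> real) \<Rightarrow> bool"
  where
  "DSIC n x p \<longleftrightarrow>
     (\<forall>v\<in>value_profiles n. \<forall>i<n. \<forall>b\<ge>0.
        v i * x i v - p i v \<ge> v i * x i (v(i := b)) - p i (v(i := b)))"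

definition IR :: "nat \<Rightarrow> (nat \<Rightarrow> (nat \<Rightarrow> real) \<Rightarrow> real) \<Rightarrow> (nat \<Rightarrow> (nat \<Rightarrow> real) \<Rightarrow> real) \<Rightarrow> bool"
  where
  "IR n x p \<longleftrightarrow> (\<forall>v\<in>value_profiles n. \<forall>i<n. v i * x i v - p i v \<ge> 0)"

definition BOM :: "nat \<Rightarrow> (nat \<Rightarrow> real measure) \<Rightarrow> ennreal" where
  "BOM n F =
     (SUP (x, p) \<in> {(x, p). feasible n x p \<and> DSIC n x p \<and> IR n x p}.
        \<integral>\<^sup>+ v. ennreal (\<Sum>i<n. p i v) \<partial>(\<Pi>\<^sub>M i\<in>{..<n}. F i))"

definition approx_const :: "(real measure \<Rightarrow> bool) \<Rightarrow> real \<Rightarrow> bool" where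
  "approx_const P c \<longleftrightarrow>
     0 \<le> c \<and>
     (\<forall>n\<ge>1. \<forall>F. (\<forall>i<n. value_dist (F i) \<and> P (F i)) \<longrightarrow>
        SPA_dup1 n F \<ge> ennreal c * BOM n F)"

definition largest_approx_const :: "(real measure \<Rightarrow> bool) \<Rightarrow> real \<Rightarrow> bool" where
  "largest_approx_const P C \<longleftrightarrow> approx_const P C \<and> (\<forall>c. approx_const P c \<longrightarrow> c \<le> C)"

(* A numerical constant quoted as the decimal d is a real number x with round4 x = d. *)
definition round4 :: "real \<Rightarrow> real" where
  "round4 x = of_int (round (10 ^ 4 * x)) / 10 ^ 4"

end

theory Submission
  imports Defs
begin

text \<open>
  Lower bounds. Both constants are at least \<open>1 / 2.615 > 0.3817\<close>, since regularity implies
  quasi-regularity. Let \<open>s\<close> be the revenue of the best 1-duplicate auction. Charging a Lagrangian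
  price \<open>s\<close> for the item gives \<open>BOM \<le> s + (\<Sum>i. sup {(v - s) * (1 - F i v) | v. v > s})\<close>, so fix
  a price \<open>v i > s\<close> for each buyer. Quasi-regularity bounds \<open>F i\<close> below \<open>v i\<close> by the equal-revenue
  curve \<open>t / (t + a i)\<close> through \<open>(v i, F i (v i))\<close>. If the duplicate \<open>j\<close> is present at level \<open>t\<close> and
  has the largest \<open>a\<close>, the probability that the second highest value exceeds \<open>t\<close> is at least the
  derivative of the posted-price revenue \<open>t * (1 - (\<Prod>i. t / (t + a i)))\<close>. Integrating once up to a fixed
  price shows that the auction beats every anonymous price; integrating over all \<open>t\<close>, with buyer \<open>i\<close>
  leaving at \<open>v i\<close>, the jumps contribute at least \<open>(\<Sum>i. (v i - s) * (1 - F i (v i)))\<close>. Levels at which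
  no suitable duplicate is present cost at most \<open>3/2 * ln (3/2) * s \<le> 0.615 * s\<close> in total.

  Upper bound. One buyer has value \<open>1\<close>, the other one the equal-revenue distribution
  \<open>v / (v + a)\<close> with \<open>a = 0.571\<close>. Here \<open>BOM = 1 + a\<close>, and \<open>a\<close> is about the largest value
  for which neither duplicate yields more than \<open>1\<close>.
\<close>

section \<open>The second highest value\<close>

lemma nth1_desc_gt_iff:
  fixes xs :: "real list"
  assumes "sorted_wrt (\<ge>) xs" "2 \<le> length xs"
  shows "t < xs ! 1 \<longleftrightarrow> 2 \<le> length (filter (\<lambda>x. t < x) xs)"
proof -
  obtain x y zs where xs: "xs = x # y # zs"
    using assms(2) by (cases xs; cases "tl xs") auto
  have le: "y \<le> x" "\<forall>z\<in>set zs. z \<le> y"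
    using assms(1) by (auto simp: xs)
  show ?thesis
  proof (cases "t < y")
    case True
    then show ?thesis using le by (simp add: xs)
  next
    case False
    then have "filter (\<lambda>x. t < x) zs = []"
      using le by (force simp: filter_empty_conv)
    then show ?thesis using False by (simp add: xs)
  qed
qed

lemma second_highest_gt_iff:
  assumes "2 \<le> m"
  shows "t < second_highest m v \<longleftrightarrow> (\<exists>i<m. \<exists>k<m. i \<noteq> k \<and> t < v i \<and> t < v k)"
proof -
  let ?l = "map v [0..<m]"
  have "t < second_highest m v \<longleftrightarrow> 2 \<le> length (filter (\<lambda>x. t < x) (rev (sort ?l)))"
    unfolding second_highest_def
    using assms by (intro nth1_desc_gt_iff) (auto simp: sorted_wrt_rev)
  also have "length (filter (\<lambda>x. t < x) (rev (sort ?l))) = length (filter (\<lambda>x. t < x) ?l)"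
    by (metis length_rev mset_filter mset_sort rev_filter size_mset)
  also have "\<dots> = card {i. i < m \<and> t < v i}"
    by (simp add: length_filter_conv_card cong: conj_cong)
  also have "2 \<le> card {i. i < m \<and> t < v i} \<longleftrightarrow> (\<exists>i<m. \<exists>k<m. i \<noteq> k \<and> t < v i \<and> t < v k)"
    using card_le_Suc0_iff_eq[of "{i. i < m \<and> t < v i}"]
    by (auto simp: not_less_eq_eq[symmetric] numeral_2_eq_2)
  finally show ?thesis .
qed

text \<open>With \<open>G i\<close> the probability that the independent value \<open>i\<close> is
  at most some level, this is the probability that at most one value exceeds the level: none does,
  or exactly \<open>i\<close> does.\<close>

definition at_most_one :: "'a set \<Rightarrow> ('a \<Rightarrow> real) \<Rightarrow> real" where
  "at_most_one A G = (\<Prod>i\<in>A. G i) + (\<Sum>i\<in>A. (1 - G i) * (\<Prod>k\<in>A - {i}. G k))"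

lemma at_most_one_empty [simp]: "at_most_one {} G = 1"
  by (simp add: at_most_one_def)

text \<open>Condition on \<open>x\<close>: if it stays below the level, one of the others may exceed
  it; if it exceeds, none may.\<close>

lemma at_most_one_insert:
  assumes "finite A" "x \<notin> A"
  shows "at_most_one (insert x A) G = G x * at_most_one A G + (1 - G x) * (\<Prod>i\<in>A. G i)"
proof -
  have *: "(\<Prod>k\<in>insert x A - {i}. G k) = G x * (\<Prod>k\<in>A - {i}. G k)" if "i \<in> A" for i
  proof -
    have "insert x A - {i} = insert x (A - {i})" using that assms by auto
    then show ?thesis using assms by simp
  qed
  have "insert x A - {x} = A" using assms by auto
  then show ?thesis
    using assms
    by (simp add: at_most_one_def * algebra_simps sum_distrib_left)
qed

lemma at_most_one_ge_prod:
  assumes "finite A" "\<And>i. i \<in> A \<Longrightarrow> 0 \<le> G i \<and> G i \<le> 1"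
  shows "(\<Prod>i\<in>A. G i) \<le> at_most_one A G"
  unfolding at_most_one_def using assms by (auto intro!: sum_nonneg mult_nonneg_nonneg prod_nonneg)

lemma at_most_one_mono:
  assumes "finite A" "\<And>i. i \<in> A \<Longrightarrow> 0 \<le> G i \<and> G i \<le> H i \<and> H i \<le> 1"
  shows "at_most_one A G \<le> at_most_one A H"
  using assms
proof (induction A)
  case (insert x A)
  have P: "(\<Prod>i\<in>A. G i) \<le> (\<Prod>i\<in>A. H i)" using insert by (intro prod_mono) auto
  have IH: "at_most_one A G \<le> at_most_one A H" using insert by auto
  have GP: "(\<Prod>i\<in>A. G i) \<le> at_most_one A G"
    using insert by (intro at_most_one_ge_prod) fastforce+
  have x: "0 \<le> G x" "G x \<le> H x" "H x \<le> 1" using insert.prems by auto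
  \<comment> \<open>Raising \<open>G x\<close> moves weight from "none of the others" to the
    likelier event "at most one of the others".\<close>
  have "G x * at_most_one A G + (1 - G x) * (\<Prod>i\<in>A. G i)
      \<le> H x * at_most_one A G + (1 - H x) * (\<Prod>i\<in>A. G i)"
    using mult_right_mono[of 0 "H x - G x" "at_most_one A G - (\<Prod>i\<in>A. G i)"]
      mult_nonneg_nonneg[of "H x - G x" "at_most_one A G - (\<Prod>i\<in>A. G i)"] x GP
    by (simp add: algebra_simps)
  also have "\<dots> \<le> H x * at_most_one A H + (1 - H x) * (\<Prod>i\<in>A. H i)"
    using x P IH by (intro add_mono mult_left_mono) auto
  finally show ?case using insert by (simp add: at_most_one_insert)
qed simp

lemma at_most_one_le_1:
  assumes "finite A" "\<And>i. i \<in> A \<Longrightarrow> 0 \<le> G i \<and> G i \<le> 1"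
  shows "at_most_one A G \<le> 1"
proof -
  have "at_most_one A G \<le> at_most_one A (\<lambda>_. 1)"
    using assms by (intro at_most_one_mono) auto
  then show ?thesis by (simp add: at_most_one_def)
qed

lemma at_most_one_restrict:
  assumes "finite B" "A \<subseteq> B" "\<And>i. i \<in> B - A \<Longrightarrow> G i = 1"
  shows "at_most_one B G = at_most_one A G"
proof -
  have "at_most_one (C \<union> A) G = at_most_one A G" if "finite C" "C \<subseteq> B - A" for C
    using that
  proof (induction C)
    case (insert x C)
    then have "at_most_one (insert x (C \<union> A)) G = at_most_one (C \<union> A) G"
      using assms insert.hyps finite_subset[OF assms(2,1)]
      by (subst at_most_one_insert) auto
    with insert show ?case by auto
  qed simp
  from this[of "B - A"] assms show ?thesis by (auto simp: Un_absorb2)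
qed

section \<open>Law and expectation of the second highest value\<close>

lemma sets_real_distribution: "real_distribution D \<Longrightarrow> sets D = sets borel"
  by (simp add: real_distribution_def real_distribution_axioms_def)

lemma finite_product_prob_space_real_distribution:
  assumes "\<And>i. real_distribution (F i)" "finite I"
  shows "finite_product_prob_space F I"
proof -
  have "product_prob_space F"
    using assms by (intro product_prob_spaceI) (simp add: real_distribution_def)
  then show ?thesis
    using assms by (simp add: finite_product_prob_space_def finite_product_sigma_finite_def
        finite_product_sigma_finite_axioms_def product_prob_space_def)
qed

lemma sets_PiM_real_distribution:
  assumes "\<And>i. real_distribution (F i)"
  shows "sets (PiM I F) = sets (PiM I (\<lambda>_. borel))"
  using assms by (intro sets_PiM_cong) (auto simp: sets_real_distribution)

lemma second_highest_measurable:
  assumes "\<And>i. real_distribution (F i)" "2 \<le> m"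
  shows "second_highest m \<in> borel_measurable (PiM {..<m} F)"
proof -
  have [measurable_cong]: "sets (F i) = sets borel" for i using assms by (simp add: sets_real_distribution)
  have *: "Measurable.pred (PiM {..<m} F) (\<lambda>v. \<exists>i\<in>{..<m}. \<exists>k\<in>{..<m}. i \<noteq> k \<and> t < v i \<and> t < v k)" for t
    by measurable
  show ?thesis
    unfolding borel_measurable_iff_greater
    using * by (auto simp: second_highest_gt_iff[OF assms(2)] pred_def Bex_def lessThan_def)
qed

lemma measure_second_highest_gt:
  assumes rd: "\<And>i. real_distribution (F i)" and m: "2 \<le> m"
  shows "measure (PiM {..<m} F) {v \<in> space (PiM {..<m} F). t < second_highest m v}
           = 1 - at_most_one {..<m} (\<lambda>i. cdf (F i) t)"
proof -
  let ?P = "PiM {..<m} F"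
  interpret finite_product_prob_space F "{..<m}"
    by (rule finite_product_prob_space_real_distribution[OF rd]) simp
  have [measurable_cong]: "sets (F i) = sets borel" for i using rd by (simp add: sets_real_distribution)
  have sp: "space (F i) = UNIV" for i
    using rd[of i] by (rule real_distribution.space_eq_univ)
  have comp: "measure (F i) {t<..} = 1 - cdf (F i) t" for i
  proof -
    have "{t<..} = space (F i) - {..t}" by (auto simp: sp)
    then show ?thesis using M.prob_compl[of "{..t}" i] by (simp add: cdf_def)
  qed
  \<comment> \<open>On the box \<open>B0\<close> no value exceeds \<open>t\<close>, on
    \<open>B i\<close> exactly value \<open>i\<close> does; these disjoint boxes make up the
    complement of the event.\<close>
  define B0 where "B0 = PiE {..<m} (\<lambda>_. {..t})"
  define B where "B = (\<lambda>i. PiE {..<m} (\<lambda>k. if k = i then {t<..} else {..t}))"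
  have meas: "B0 \<in> sets ?P" "B i \<in> sets ?P" for i
    unfolding B0_def B_def by (auto intro!: sets_PiM_I_finite)
  have pB0: "measure ?P B0 = (\<Prod>i<m. cdf (F i) t)"
    unfolding B0_def by (subst prob_times) (auto simp: cdf_def)
  have pB: "measure ?P (B i) = (1 - cdf (F i) t) * (\<Prod>k\<in>{..<m} - {i}. cdf (F k) t)" if "i < m" for i
  proof -
    have "measure ?P (B i) = (\<Prod>k<m. measure (F k) (if k = i then {t<..} else {..t}))"
      unfolding B_def by (subst prob_times) auto
    also have "\<dots> = measure (F i) {t<..} * (\<Prod>k\<in>{..<m} - {i}. measure (F k) (if k = i then {t<..} else {..t}))"
      using that by (subst prod.remove[of _ i]) auto
    also have "\<dots> = (1 - cdf (F i) t) * (\<Prod>k\<in>{..<m} - {i}. cdf (F k) t)"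
      unfolding comp cdf_def by (intro arg_cong2[where f = "(*)"] prod.cong) auto
    finally show ?thesis .
  qed
  have Bmem: "v \<in> B i \<longleftrightarrow> v \<in> extensional {..<m} \<and> t < v i \<and> (\<forall>k<m. k \<noteq> i \<longrightarrow> v k \<le> t)" if "i < m" for i v
    using that by (auto simp: B_def PiE_iff split: if_splits)
  have disj: "disjoint_family_on B {..<m}"
    by (force simp: disjoint_family_on_def Bmem)
  have disj0: "B0 \<inter> (\<Union>i<m. B i) = {}"
    by (force simp: Bmem B0_def PiE_iff)
  have eq: "{v \<in> space ?P. t < second_highest m v} = space ?P - (B0 \<union> (\<Union>i<m. B i))"
  proof (rule set_eqI)
    fix v
    show "v \<in> {v \<in> space ?P. t < second_highest m v} \<longleftrightarrow> v \<in> space ?P - (B0 \<union> (\<Union>i<m. B i))"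
      unfolding Diff_iff Un_iff UN_iff mem_Collect_eq second_highest_gt_iff[OF m]
      by (simp add: space_PiM sp B0_def PiE_iff Bmem cong: conj_cong bex_cong)
         (metis not_le lessThan_iff)
  qed
  have "measure ?P {v \<in> space ?P. t < second_highest m v} = 1 - measure ?P (B0 \<union> (\<Union>i<m. B i))"
    unfolding eq using meas by (intro prob_compl) auto
  also have "measure ?P (B0 \<union> (\<Union>i<m. B i)) = measure ?P B0 + (\<Sum>i<m. measure ?P (B i))"
    using meas disj disj0
    by (subst finite_measure_Union) (auto intro!: finite_measure_finite_Union)
  also have "\<dots> = at_most_one {..<m} (\<lambda>i. cdf (F i) t)"
    by (simp add: at_most_one_def pB0 pB)
  finally show ?thesis .
qed

text \<open>Write \<open>ennreal (f x)\<close> as the length of the interval from 0 to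
  \<open>f x\<close> and exchange the integrals. Where \<open>f x\<close> is negative, both
  vanish.\<close>

lemma nn_integral_layer_cake:
  assumes "sigma_finite_measure M" and [measurable]: "f \<in> borel_measurable M"
  shows "(\<integral>\<^sup>+ x. ennreal (f x) \<partial>M)
           = (\<integral>\<^sup>+ t. indicator {0<..} t * emeasure M {x \<in> space M. t < f x} \<partial>lborel)"
proof -
  interpret sigma_finite_measure M by fact
  interpret pair_sigma_finite lborel M ..
  let ?g = "\<lambda>t x. if 0 < t \<and> t < f x then 1 else 0 :: ennreal"
  have "(\<integral>\<^sup>+ x. ennreal (f x) \<partial>M) = (\<integral>\<^sup>+ x. (\<integral>\<^sup>+ t. ?g t x \<partial>lborel) \<partial>M)"
  proof (rule nn_integral_cong)
    fix x
    have "(\<integral>\<^sup>+ t. ?g t x \<partial>lborel) = (\<integral>\<^sup>+ t. indicator {0<..<f x} t \<partial>lborel)"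
      by (intro nn_integral_cong) (auto simp: indicator_def)
    also have "\<dots> = ennreal (f x)"
      by (cases "0 \<le> f x") (auto simp: ennreal_neg)
    finally show "ennreal (f x) = (\<integral>\<^sup>+ t. ?g t x \<partial>lborel)" ..
  qed
  also have "\<dots> = (\<integral>\<^sup>+ t. (\<integral>\<^sup>+ x. ?g t x \<partial>M) \<partial>lborel)"
    by (rule Fubini') measurable
  also have "\<dots> = (\<integral>\<^sup>+ t. indicator {0<..} t * emeasure M {x \<in> space M. t < f x} \<partial>lborel)"
  proof (rule nn_integral_cong)
    fix t
    have "(\<integral>\<^sup>+ x. ?g t x \<partial>M)
        = (\<integral>\<^sup>+ x. indicator {0<..} t * indicator {x \<in> space M. t < f x} x \<partial>M)"
      by (intro nn_integral_cong) (auto simp: indicator_def)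
    also have "\<dots> = indicator {0<..} t * emeasure M {x \<in> space M. t < f x}"
      by (subst nn_integral_cmult) auto
    finally show "(\<integral>\<^sup>+ x. ?g t x \<partial>M) = indicator {0<..} t * emeasure M {x \<in> space M. t < f x}" .
  qed
  finally show ?thesis .
qed

lemma SPA_eq_integral:
  assumes rd: "\<And>i. real_distribution (F i)" and m: "2 \<le> m"
  shows "SPA m F = (\<integral>\<^sup>+ t. indicator {0<..} t * ennreal (1 - at_most_one {..<m} (\<lambda>i. cdf (F i) t)) \<partial>lborel)"
proof -
  interpret finite_product_prob_space F "{..<m}"
    by (rule finite_product_prob_space_real_distribution[OF rd]) simp
  show ?thesis
    unfolding SPA_def
    by (subst nn_integral_layer_cake[OF sigma_finite_measure_axioms second_highest_measurable[OF rd m]])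
       (simp add: emeasure_eq_measure measure_second_highest_gt[OF rd m])
qed

section \<open>Equal-revenue curves\<close>

text \<open>The derivative in \<open>t\<close> of the revenue from an anonymous price
  \<open>t\<close> when buyer \<open>i\<close> has distribution function
  \<open>t / (t + a i)\<close>.\<close>

definition post_density :: "'a set \<Rightarrow> ('a \<Rightarrow> real) \<Rightarrow> real \<Rightarrow> real" where
  "post_density A a t = 1 - (\<Prod>i\<in>A. t / (t + a i)) * (1 + (\<Sum>i\<in>A. a i / (t + a i)))"

lemma post_density_measurable [measurable]: "post_density A a \<in> borel_measurable borel"
  unfolding post_density_def by measurable

lemma has_real_derivative_post:
  assumes "finite A" "\<And>i. i \<in> A \<Longrightarrow> 0 < a i" "0 \<le> t"
  shows "((\<lambda>t. t * (1 - (\<Prod>i\<in>A. t / (t + a i)))) has_real_derivative post_density A a t) (at t)"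
proof -
  \<comment> \<open>The derivative of the product is described through \<open>t * D\<close>, which
    avoids dividing by \<open>t\<close> and so covers \<open>t = 0\<close>.\<close>
  have "\<exists>D. ((\<lambda>t. \<Prod>i\<in>A. t / (t + a i)) has_real_derivative D) (at t) \<and>
         t * D = (\<Prod>i\<in>A. t / (t + a i)) * (\<Sum>i\<in>A. a i / (t + a i))"
    using assms
  proof (induction A)
    case empty
    show ?case by (rule exI[of _ 0]) auto
  next
    case (insert x A)
    let ?P = "\<lambda>t. \<Prod>i\<in>A. t / (t + a i)" and ?S = "\<Sum>i\<in>A. a i / (t + a i)"
    obtain D where D: "(?P has_real_derivative D) (at t)" "t * D = ?P t * ?S"
      using insert by auto
    have pos: "0 < t + a x" using insert.prems by (intro add_nonneg_pos) auto
    have dx: "((\<lambda>t. t / (t + a x)) has_real_derivative a x / (t + a x)^2) (at t)"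
      using pos by (auto intro!: derivative_eq_intros simp: field_simps power2_eq_square)
    have "t * (a x / (t + a x)^2 * ?P t + D * (t / (t + a x)))
        = (t / (t + a x)) * ?P t * (a x / (t + a x)) + (t * D) * (t / (t + a x))"
      by (simp add: algebra_simps power2_eq_square)
    also have "\<dots> = (t / (t + a x) * ?P t) * (a x / (t + a x) + ?S)"
      unfolding D(2) by (simp add: algebra_simps)
    finally show ?case
      using insert.hyps DERIV_mult[OF dx D(1)] by auto
  qed
  then obtain D where D: "((\<lambda>t. \<Prod>i\<in>A. t / (t + a i)) has_real_derivative D) (at t)"
    "t * D = (\<Prod>i\<in>A. t / (t + a i)) * (\<Sum>i\<in>A. a i / (t + a i))" by blast
  have "post_density A a t = 1 * (1 - (\<Prod>i\<in>A. t / (t + a i))) + (0 - D) * t"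
    unfolding post_density_def distrib_left D(2)[symmetric] by (simp add: algebra_simps)
  then show ?thesis
    using DERIV_mult[OF DERIV_ident DERIV_diff[OF DERIV_const[of 1] D(1)]] by simp
qed

text \<open>A new buyer with \<open>u = a x / (t + a x)\<close> turns the bracket
  \<open>1 + S\<close> into \<open>(1 - u) * (1 + S + u) = (1 + S) - u * (S + u)\<close>, which is
  no larger, so the subtracted term stays at most 1.\<close>

lemma post_density_nonneg:
  assumes "finite A" "\<And>i. i \<in> A \<Longrightarrow> 0 < a i" "0 \<le> t"
  shows "0 \<le> post_density A a t"
proof -
  have "(\<Prod>i\<in>A. t / (t + a i)) * (1 + (\<Sum>i\<in>A. a i / (t + a i))) \<le> 1"
    using assms
  proof (induction A)
    case (insert x A)
    let ?P = "\<Prod>i\<in>A. t / (t + a i)" and ?S = "\<Sum>i\<in>A. a i / (t + a i)"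
    define u where "u = a x / (t + a x)"
    have pos: "0 < t + a x" using insert.prems by (intro add_nonneg_pos) auto
    have "0 < a x" using insert.prems by auto
    then have u: "0 \<le> u" "t / (t + a x) = 1 - u" using pos by (auto simp: u_def field_simps)
    have P: "0 \<le> ?P" and S: "0 \<le> ?S"
      using insert.prems(2) less_imp_le[OF insert.prems(1)]
      by (auto intro!: prod_nonneg sum_nonneg divide_nonneg_nonneg add_nonneg_nonneg)
    have "(1 - u) * ?P * (1 + (u + ?S)) = ?P * (1 + ?S) - ?P * (u * (?S + u))"
      by (simp add: algebra_simps)
    also have "\<dots> \<le> ?P * (1 + ?S)" using P S u by simp
    also have "\<dots> \<le> 1" using insert by auto
    finally show ?case using insert.hyps by (simp add: u u_def)
  qed simp
  then show ?thesis by (simp add: post_density_def)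
qed

lemma nn_integral_post_density:
  assumes "finite A" "\<And>i. i \<in> A \<Longrightarrow> 0 < a i" "0 \<le> v"
  shows "(\<integral>\<^sup>+ t. indicator {0<..<v} t * ennreal (post_density A a t) \<partial>lborel)
           = ennreal (v * (1 - (\<Prod>i\<in>A. v / (v + a i))))"
proof -
  have "(\<integral>\<^sup>+ t. indicator {0<..<v} t * ennreal (post_density A a t) \<partial>lborel)
      = (\<integral>\<^sup>+ t. ennreal (post_density A a t) * indicator {0..v} t \<partial>lborel)"
  proof (rule nn_integral_cong_AE)
    show "AE t in lborel. indicator {0<..<v} t * ennreal (post_density A a t)
            = ennreal (post_density A a t) * indicator {0..v} t"
      using AE_lborel_singleton[of 0] AE_lborel_singleton[of v]
      by eventually_elim (auto simp: indicator_def)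
  qed
  also have "\<dots> = ennreal (v * (1 - (\<Prod>i\<in>A. v / (v + a i))) - 0 * (1 - (\<Prod>i\<in>A. 0 / (0 + a i))))"
    using assms by (intro nn_integral_FTC_Icc has_real_derivative_post post_density_nonneg) auto
  finally show ?thesis by simp
qed

lemma prod_le_prod_subset:
  fixes f :: "'a \<Rightarrow> real"
  assumes "finite B" "A \<subseteq> B" "\<And>i. i \<in> B \<Longrightarrow> 0 \<le> f i" "\<And>i. i \<in> B \<Longrightarrow> f i \<le> 1"
  shows "prod f B \<le> prod f A"
proof -
  have "prod f B = prod f (B - A) * prod f A"
    using assms by (intro prod.subset_diff)
  also have "\<dots> \<le> 1 * prod f A"
    using assms by (intro mult_right_mono prod_le_1 prod_nonneg) auto
  finally show ?thesis by simp
qed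

text \<open>The sign of \<open>b\<close> is left open because the summand
  \<open>a x * (1 - s / v x)\<close> added below may be negative.\<close>

lemma ennreal_add_le_shift:
  assumes "ennreal y \<le> ennreal c + X" "0 \<le> c"
  shows "ennreal (b + y) \<le> ennreal (b + c) + X"
proof (cases X)
  case (real r)
  then have "y \<le> c + r"
    using assms by (simp add: ennreal_plus[symmetric] ennreal_le_iff del: ennreal_plus)
  then have "ennreal (b + y) \<le> ennreal (b + c + r)" by (intro ennreal_leI) simp
  also have "\<dots> \<le> ennreal (b + c) + ennreal r"
    using real by (cases "0 \<le> b + c") (auto simp: ennreal_neg intro!: ennreal_leI)
  finally show ?thesis by (simp add: real)
qed simp

lemma nn_integral_split_at:
  fixes f :: "real \<Rightarrow> ennreal"
  assumes [measurable]: "f \<in> borel_measurable borel" and "0 < v"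
  shows "(\<integral>\<^sup>+ t. indicator {0<..} t * f t \<partial>lborel)
    = (\<integral>\<^sup>+ t. indicator {0<..<v} t * f t \<partial>lborel) + (\<integral>\<^sup>+ t. indicator {v..} t * f t \<partial>lborel)"
  using assms(2)
  by (subst nn_integral_add[symmetric]) (auto intro!: nn_integral_cong simp: indicator_def)

lemma post_density_Collect_measurable [measurable]:
  assumes "finite S"
  shows "(\<lambda>t. post_density {i\<in>S. t < v i} a t) \<in> borel_measurable borel"
proof -
  have eq: "post_density {i\<in>S. t < v i} a t
    = 1 - (\<Prod>i\<in>S. if t < v i then t / (t + a i) else 1) * (1 + (\<Sum>i\<in>S. if t < v i then a i / (t + a i) else 0))" for t
    using assms by (simp add: post_density_def sum.inter_filter prod.inter_filter)
  show ?thesis unfolding eq by measurable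
qed

text \<open>The antiderivative \<open>t * (1 - (\<Prod>i. t / (t + a i)))\<close> drops at \<open>v i\<close>, where buyer \<open>i\<close> leaves, by
  \<open>a i\<close> times the remaining product; these drops add up to the integral.\<close>

lemma sum_le_nn_integral_post_density:
  assumes "finite S" "0 < s" "\<And>i. i \<in> S \<Longrightarrow> 0 < a i \<and> 0 < v i"
    and "\<And>i. i \<in> S \<Longrightarrow> 1 - s / v i \<le> (\<Prod>k\<in>{k\<in>S. v i \<le> v k}. v i / (v i + a k))"
  shows "ennreal (\<Sum>i\<in>S. a i * (1 - s / v i))
           \<le> (\<integral>\<^sup>+ t. indicator {0<..} t * ennreal (post_density {i\<in>S. t < v i} a t) \<partial>lborel)"
  using assms(1,3,4)
\<comment> \<open>Ranking by \<open>- v\<close> inserts buyers in order of decreasing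
  \<open>v\<close>. The new buyer \<open>x\<close> is the first to leave, so the integrand changes
  only below \<open>v x\<close>, where everybody is still present.\<close>
proof (induction S rule: finite_ranking_induct[where f = "\<lambda>i. - v i"])
  case empty
  then show ?case by simp
next
  case (insert x S)
  show ?case
  proof (cases "x \<in> S")
    case True
    then show ?thesis using insert by (simp add: insert_absorb)
  next
    case False
    let ?T = "insert x S"
    let ?P = "\<lambda>A. \<Prod>k\<in>A. v x / (v x + a k)"
    note [measurable] = \<open>finite S\<close>
    have fT [measurable]: "finite ?T" using insert by simp
    have vx: "0 < v x" "0 < a x" using insert.prems by auto
    have vle: "v x \<le> v i" if "i \<in> S" for i using insert(2)[OF that] by simp
    have "ennreal (\<Sum>i\<in>S. a i * (1 - s / v i))
        \<le> (\<integral>\<^sup>+ t. indicator {0<..} t * ennreal (post_density {i\<in>S. t < v i} a t) \<partial>lborel)"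
    proof (rule insert.IH)
      fix i assume i: "i \<in> S"
      have "1 - s / v i \<le> (\<Prod>k\<in>{k\<in>?T. v i \<le> v k}. v i / (v i + a k))" using insert.prems i by auto
      also have "\<dots> \<le> (\<Prod>k\<in>{k\<in>S. v i \<le> v k}. v i / (v i + a k))"
      proof (rule prod_le_prod_subset)
        fix k assume "k \<in> {k\<in>?T. v i \<le> v k}"
        then have "0 < a k" "0 < v i" using insert.prems i by auto
        then show "0 \<le> v i / (v i + a k)" "v i / (v i + a k) \<le> 1" by auto
      qed (use insert in auto)
      finally show "1 - s / v i \<le> (\<Prod>k\<in>{k\<in>S. v i \<le> v k}. v i / (v i + a k))" .
    qed (use insert.prems in auto)
    also have "\<dots> = (\<integral>\<^sup>+ t. indicator {0<..<v x} t * ennreal (post_density {i\<in>S. t < v i} a t) \<partial>lborel)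
        + (\<integral>\<^sup>+ t. indicator {v x..} t * ennreal (post_density {i\<in>S. t < v i} a t) \<partial>lborel)" (is "_ = _ + ?X")
      using vx by (intro nn_integral_split_at) measurable
    also have "(\<integral>\<^sup>+ t. indicator {0<..<v x} t * ennreal (post_density {i\<in>S. t < v i} a t) \<partial>lborel)
        = (\<integral>\<^sup>+ t. indicator {0<..<v x} t * ennreal (post_density S a t) \<partial>lborel)"
    proof (rule nn_integral_cong)
      fix t
      have "{i\<in>S. t < v i} = S" if "t < v x" using vle that by force
      then show "indicator {0<..<v x} t * ennreal (post_density {i\<in>S. t < v i} a t)
        = indicator {0<..<v x} t * ennreal (post_density S a t)" by (auto simp: indicator_def)
    qed
    also have "\<dots> = ennreal (v x * (1 - ?P S))"
      using insert less_imp_le[OF vx(1)] by (intro nn_integral_post_density) auto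
    finally have 1: "ennreal (\<Sum>i\<in>S. a i * (1 - s / v i)) \<le> ennreal (v x * (1 - ?P S)) + ?X" .
    have "(\<integral>\<^sup>+ t. indicator {0<..} t * ennreal (post_density {i\<in>?T. t < v i} a t) \<partial>lborel)
      = (\<integral>\<^sup>+ t. indicator {0<..<v x} t * ennreal (post_density {i\<in>?T. t < v i} a t) \<partial>lborel)
        + (\<integral>\<^sup>+ t. indicator {v x..} t * ennreal (post_density {i\<in>?T. t < v i} a t) \<partial>lborel)"
      using vx by (intro nn_integral_split_at) measurable
    also have "(\<integral>\<^sup>+ t. indicator {v x..} t * ennreal (post_density {i\<in>?T. t < v i} a t) \<partial>lborel) = ?X"
    proof (rule nn_integral_cong)
      fix t
      have "{i\<in>?T. t < v i} = {i\<in>S. t < v i}" if "v x \<le> t" using that by auto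
      then show "indicator {v x..} t * ennreal (post_density {i\<in>?T. t < v i} a t)
        = indicator {v x..} t * ennreal (post_density {i\<in>S. t < v i} a t)" by (auto simp: indicator_def)
    qed
    also have "(\<integral>\<^sup>+ t. indicator {0<..<v x} t * ennreal (post_density {i\<in>?T. t < v i} a t) \<partial>lborel)
        = (\<integral>\<^sup>+ t. indicator {0<..<v x} t * ennreal (post_density ?T a t) \<partial>lborel)"
    proof (rule nn_integral_cong)
      fix t
      have "{i\<in>?T. t < v i} = ?T" if "t < v x" using vle that by force
      then show "indicator {0<..<v x} t * ennreal (post_density {i\<in>?T. t < v i} a t)
        = indicator {0<..<v x} t * ennreal (post_density ?T a t)" by (auto simp: indicator_def)
    qed
    also have "\<dots> = ennreal (v x * (1 - ?P ?T))"
      using insert less_imp_le[OF vx(1)] fT by (intro nn_integral_post_density) auto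
    finally have 2: "(\<integral>\<^sup>+ t. indicator {0<..} t * ennreal (post_density {i\<in>?T. t < v i} a t) \<partial>lborel)
      = ennreal (v x * (1 - ?P ?T)) + ?X" .
    have PT: "?P ?T = v x / (v x + a x) * ?P S" using False insert by simp
    have "{k\<in>?T. v x \<le> v k} = ?T" using vle by auto
    then have "1 - s / v x \<le> ?P ?T" using insert.prems(2)[of x] by simp
    then have "a x * (1 - s / v x) \<le> a x * ?P ?T" using vx by simp
    \<comment> \<open>The presence of \<open>x\<close> raises the revenue at price
      \<open>v x\<close> by \<open>v x * ?P S * a x / (v x + a x)\<close>, which is
      \<open>a x * ?P ?T\<close>.\<close>
    also have "\<dots> = v x * (1 - ?P ?T) - v x * (1 - ?P S)"
      unfolding PT using vx by (simp add: field_simps)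
    finally have 3: "a x * (1 - s / v x) + v x * (1 - ?P S) \<le> v x * (1 - ?P ?T)" by simp
    have "0 \<le> v x / (v x + a k) \<and> v x / (v x + a k) \<le> 1" if "k \<in> S" for k
    proof -
      have "0 < a k" using insert.prems that by auto
      then show ?thesis using vx by simp
    qed
    then have "0 \<le> ?P S" "?P S \<le> 1" by (auto intro!: prod_nonneg prod_le_1)
    then have nn: "0 \<le> v x * (1 - ?P S)" using vx by simp
    have "ennreal (\<Sum>i\<in>?T. a i * (1 - s / v i)) = ennreal (a x * (1 - s / v x) + (\<Sum>i\<in>S. a i * (1 - s / v i)))"
      using False insert by simp
    also have "\<dots> \<le> ennreal (a x * (1 - s / v x) + v x * (1 - ?P S)) + ?X"
      using 1 nn by (rule ennreal_add_le_shift)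
    also have "\<dots> \<le> ennreal (v x * (1 - ?P ?T)) + ?X"
      using 3 by (intro add_mono ennreal_leI) auto
    finally show ?thesis using 2 by simp
  qed
qed

section \<open>Equal-revenue curves against second-price probabilities\<close>

lemma at_most_one_eq_prod:
  assumes "finite A" "\<And>i. i \<in> A \<Longrightarrow> 0 < G i"
  shows "at_most_one A G = (\<Prod>i\<in>A. G i) * (1 + (\<Sum>i\<in>A. (1 - G i) / G i))"
proof -
  have "(\<Prod>k\<in>A - {i}. G k) = (\<Prod>k\<in>A. G k) / G i" if "i \<in> A" for i
    using assms that by (simp add: prod.remove[of A i] less_imp_neq[symmetric])
  then show ?thesis
    by (simp add: at_most_one_def algebra_simps sum_distrib_left)
qed

text \<open>The odds of exceeding \<open>t\<close> are \<open>a i / t\<close>, linear in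
  \<open>a i\<close>; this lets a duplicate be absorbed exactly in the next lemma.\<close>

lemma at_most_one_triangular:
  assumes "finite A" "\<And>i. i \<in> A \<Longrightarrow> 0 < a i" "0 < t"
  shows "at_most_one A (\<lambda>i. t / (t + a i)) = (\<Prod>i\<in>A. t / (t + a i)) * (1 + (\<Sum>i\<in>A. a i / t))"
proof -
  have "(1 - t / (t + a i)) / (t / (t + a i)) = a i / t" if "i \<in> A" for i
  proof -
    have "0 < t + a i" using assms that by (simp add: add_pos_pos)
    then have "1 - t / (t + a i) = a i / (t + a i)" by (simp add: field_simps)
    then show ?thesis using \<open>0 < t + a i\<close> assms(3) by simp
  qed
  then show ?thesis
    using assms by (subst at_most_one_eq_prod) (auto intro!: divide_pos_pos add_pos_pos)
qed

text \<open>The duplicate multiplies the product by \<open>t / (t + a j)\<close> and adds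
  \<open>a j / t\<close> to the sum, which together turn \<open>1 + (\<Sum>i. a i / t)\<close> into
  \<open>1 + (\<Sum>i. a i / (t + a j))\<close>. As \<open>a j\<close> is the largest parameter,
  this is at most the bracket in \<open>post_density\<close>.\<close>

lemma post_density_le_dup:
  assumes A: "finite A" "n \<notin> A" "j \<in> A" and a: "\<And>i. i \<in> A \<Longrightarrow> 0 < a i \<and> a i \<le> a j" and "0 < t"
  shows "post_density A a t \<le> 1 - at_most_one (insert n A) (\<lambda>i. t / (t + (if i = n then a j else a i)))"
proof -
  let ?b = "\<lambda>i. if i = n then a j else a i"
  define P where "P = (\<Prod>i\<in>A. t / (t + a i))"
  have aj: "0 < a j" "0 < t + a j" using a[OF A(3)] \<open>0 < t\<close> by auto
  have P: "0 \<le> P" unfolding P_def using a \<open>0 < t\<close> by (intro prod_nonneg) (simp add: less_imp_le add_pos_pos)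
  have Peq: "(\<Prod>i\<in>A. t / (t + ?b i)) = P" unfolding P_def using A by (intro prod.cong) auto
  have Seq: "(\<Sum>i\<in>A. ?b i / t) = (\<Sum>i\<in>A. a i / t)" using A by (intro sum.cong) auto
  have "at_most_one (insert n A) (\<lambda>i. t / (t + ?b i)) = t / (t + a j) * P * (1 + (a j / t + (\<Sum>i\<in>A. a i / t)))"
    using assms aj by (subst at_most_one_triangular) (auto simp: Peq Seq)
  also have "\<dots> = P * (1 + (\<Sum>i\<in>A. a i / (t + a j)))"
  proof -
    let ?S = "\<Sum>i\<in>A. a i"
    have "1 + (a j / t + ?S / t) = (t + a j + ?S) / t" using \<open>0 < t\<close> by (simp add: field_simps)
    moreover have "1 + ?S / (t + a j) = (t + a j + ?S) / (t + a j)" using aj by (simp add: field_simps)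
    ultimately show ?thesis using \<open>0 < t\<close> by (simp add: sum_divide_distrib[symmetric] mult.commute)
  qed
  also have "\<dots> \<le> P * (1 + (\<Sum>i\<in>A. a i / (t + a i)))"
  proof (intro mult_left_mono add_left_mono sum_mono P)
    fix i assume "i \<in> A"
    then have "0 < a i" "a i \<le> a j" using a by auto
    then show "a i / (t + a j) \<le> a i / (t + a i)"
      using \<open>0 < t\<close> by (intro divide_left_mono) (auto intro!: mult_pos_pos)
  qed
  finally show ?thesis by (simp add: post_density_def P_def)
qed

text \<open>The difference is the probability \<open>E\<close> that exactly one value exceeds the
  level. Since "none" has probability at most \<open>1 - E\<close>, a new value turns
  \<open>E\<close> into at most \<open>G x * E + (1 - G x) * (1 - E)\<close>, which is at most 1/2
  when \<open>E \<le> 1/2 \<le> G x\<close>.\<close>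

lemma exactly_one_le_half:
  assumes "finite A" "\<And>i. i \<in> A \<Longrightarrow> 0 \<le> G i \<and> G i \<le> 1 \<and> 1/2 \<le> G i"
  shows "at_most_one A G - (\<Prod>i\<in>A. G i) \<le> 1/2"
  using assms
proof (induction A)
  case (insert x A)
  let ?P = "\<Prod>i\<in>A. G i" and ?N = "at_most_one A G"
  have "?N - ?P \<le> 1/2" using insert by auto
  moreover have "?N \<le> 1" using insert by (intro at_most_one_le_1) auto
  moreover have g: "1/2 \<le> G x" "G x \<le> 1" using insert by auto
  ultimately have "G x * (?N - ?P) + (1 - G x) * ?P \<le> G x * (?N - ?P) + (1 - G x) * (1 - (?N - ?P))"
    by (intro add_left_mono mult_left_mono) auto
  also have "\<dots> = (1 - G x) + (2 * G x - 1) * (?N - ?P)" by (simp add: algebra_simps)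
  also have "\<dots> \<le> (1 - G x) + (2 * G x - 1) * (1/2)"
    using g \<open>?N - ?P \<le> 1/2\<close> by (intro add_left_mono mult_left_mono) auto
  finally show ?case
    using insert by (simp add: at_most_one_insert algebra_simps)
qed simp

text \<open>Without a duplicate the second-price probability falls short of \<open>post_density\<close> by
  \<open>(\<Prod>i. t / (t + a i)) * (\<Sum>i. (a i)\<^sup>2 / (t * (t + a i)))\<close>, which is at most \<open>s / (t + s)\<close> times the
  probability that exactly one value exceeds \<open>t\<close>.\<close>

definition no_dup_loss :: "real \<Rightarrow> real \<Rightarrow> real" where
  "no_dup_loss s t = s / (t + s) * min (1/2) (s / t)"

lemma no_dup_loss_measurable [measurable]: "no_dup_loss s \<in> borel_measurable borel"
  unfolding no_dup_loss_def by measurable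

lemma no_dup_loss_nonneg: "0 \<le> s \<Longrightarrow> 0 \<le> t \<Longrightarrow> 0 \<le> no_dup_loss s t"
  by (simp add: no_dup_loss_def)

lemma post_density_le_no_dup:
  assumes A: "finite A" and a: "\<And>i. i \<in> A \<Longrightarrow> 0 < a i \<and> a i \<le> s" and "0 < s" "s \<le> t"
    and P: "1 - s / t \<le> (\<Prod>i\<in>A. t / (t + a i))"
  shows "post_density A a t \<le> 1 - at_most_one A (\<lambda>i. t / (t + a i)) + no_dup_loss s t"
proof -
  let ?P = "\<Prod>i\<in>A. t / (t + a i)" and ?N = "at_most_one A (\<lambda>i. t / (t + a i))"
  have t: "0 < t" using assms by simp
  have G: "0 \<le> t / (t + a i) \<and> t / (t + a i) \<le> 1 \<and> 1/2 \<le> t / (t + a i)" if "i \<in> A" for i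
  proof -
    have "0 < a i" "a i \<le> t" using a[OF that] assms by auto
    then show ?thesis using t by (simp add: field_simps)
  qed
  have N: "?N = ?P * (1 + (\<Sum>i\<in>A. a i / t))"
    using assms t by (intro at_most_one_triangular) auto
  have P0: "0 \<le> ?P" using G by (intro prod_nonneg) auto
  \<comment> \<open>Two bounds on the probability that exactly one value exceeds \<open>t\<close>:
    1/2, because \<open>a i \<le> s \<le> t\<close>, and \<open>s / t\<close>, from the assumed
    lower bound on the product. They form the minimum in \<open>no_dup_loss\<close>.\<close>
  have "?N - ?P \<le> 1/2" using A G by (intro exactly_one_le_half) auto
  moreover have "?N - ?P \<le> s / t"
  proof -
    have "?N \<le> 1" using A G by (intro at_most_one_le_1) auto
    then show ?thesis using P by simp
  qed
  ultimately have E: "?N - ?P \<le> min (1/2) (s / t)" by simp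
  have "post_density A a t - (1 - ?N) = ?P * (\<Sum>i\<in>A. a i / t - a i / (t + a i))"
    unfolding N post_density_def by (simp add: algebra_simps sum_subtractf)
  also have "\<dots> \<le> ?P * (\<Sum>i\<in>A. s / (t + s) * (a i / t))"
  proof (intro mult_left_mono sum_mono P0)
    fix i assume "i \<in> A"
    then have ai: "0 < a i" "a i \<le> s" using a by auto
    have "a i / t - a i / (t + a i) = a i / (t + a i) * (a i / t)"
      using ai t by (simp add: field_simps)
    also have "\<dots> \<le> s / (t + s) * (a i / t)"
    proof (intro mult_right_mono)
      show "a i / (t + a i) \<le> s / (t + s)" using ai t by (simp add: field_simps)
    qed (use ai t in simp)
    finally show "a i / t - a i / (t + a i) \<le> s / (t + s) * (a i / t)" .
  qed
  also have "\<dots> = s / (t + s) * (?N - ?P)"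
    unfolding N sum_distrib_left[symmetric] by (simp add: ring_distribs mult.left_commute)
  also have "\<dots> \<le> no_dup_loss s t"
    unfolding no_dup_loss_def using E \<open>0 < s\<close> t by (intro mult_left_mono) auto
  finally show ?thesis by simp
qed

text \<open>The two terms of the minimum cross at \<open>t = 2 * s\<close>. The range from
  \<open>s\<close> to there contributes \<open>s / 2 * ln (3/2)\<close>, the tail
  \<open>s * ln (3/2)\<close>.\<close>

lemma nn_integral_no_dup_loss:
  assumes "0 < s"
  shows "(\<integral>\<^sup>+ t. indicator {s..} t * ennreal (no_dup_loss s t) \<partial>lborel) \<le> ennreal (3/2 * ln (3/2) * s)"
proof -
  let ?f = "\<lambda>t. s / (2 * (t + s))" and ?g = "\<lambda>t. s * s / (t * (t + s))"
  have "(\<integral>\<^sup>+ t. indicator {s..} t * ennreal (no_dup_loss s t) \<partial>lborel)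
      \<le> (\<integral>\<^sup>+ t. ennreal (?f t) * indicator {s..2 * s} t + ennreal (?g t) * indicator {2 * s..} t \<partial>lborel)"
  proof (rule nn_integral_mono)
    fix t
    have "no_dup_loss s t \<le> ?f t" if "s \<le> t"
    proof -
      have "no_dup_loss s t \<le> s / (t + s) * (1/2)"
        unfolding no_dup_loss_def using that assms by (intro mult_left_mono min.cobounded1) auto
      then show ?thesis by (simp add: mult.commute)
    qed
    moreover have "no_dup_loss s t \<le> ?g t" if "s \<le> t"
    proof -
      have "no_dup_loss s t \<le> s / (t + s) * (s / t)"
        unfolding no_dup_loss_def using that assms by (intro mult_left_mono min.cobounded2) auto
      then show ?thesis by (simp add: mult.commute)
    qed
    ultimately show "indicator {s..} t * ennreal (no_dup_loss s t)
        \<le> ennreal (?f t) * indicator {s..2 * s} t + ennreal (?g t) * indicator {2 * s..} t"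
      using assms by (auto simp: indicator_def intro!: ennreal_leI add_increasing)
  qed
  also have "\<dots> = (\<integral>\<^sup>+ t. ennreal (?f t) * indicator {s..2 * s} t \<partial>lborel)
      + (\<integral>\<^sup>+ t. ennreal (?g t) * indicator {2 * s..} t \<partial>lborel)"
    by (intro nn_integral_add) auto
  also have "(\<integral>\<^sup>+ t. ennreal (?f t) * indicator {s..2 * s} t \<partial>lborel)
      = ennreal (s / 2 * ln (2 * s + s) - s / 2 * ln (s + s))"
  proof (rule nn_integral_FTC_Icc)
    fix t assume "t \<in> {s..2 * s}"
    then have "0 < t + s" using assms by auto
    then show "((\<lambda>t. s / 2 * ln (t + s)) has_real_derivative ?f t) (at t)" "0 \<le> ?f t"
      using assms by (auto intro!: derivative_eq_intros simp: field_simps)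
  qed (use assms in auto)
  also have "s / 2 * ln (2 * s + s) - s / 2 * ln (s + s) = s / 2 * ln (3/2)"
  proof -
    have "ln (2 * s + s) = ln ((s + s) * (3/2))" by simp
    also have "\<dots> = ln (s + s) + ln (3/2)" using assms by (subst ln_mult) auto
    finally show ?thesis by (simp add: algebra_simps)
  qed
  also have "(\<integral>\<^sup>+ t. ennreal (?g t) * indicator {2 * s..} t \<partial>lborel)
      = ennreal (0 - s * ln (2 * s / (2 * s + s)))"
  proof (rule nn_integral_FTC_atLeast)
    fix t assume "2 * s \<le> t"
    then have t: "0 < t" "0 < t + s" using assms by auto
    have "((\<lambda>t. t / (t + s)) has_real_derivative s / (t + s)^2) (at t)"
      using t by (auto intro!: derivative_eq_intros simp: field_simps power2_eq_square)
    then have "((\<lambda>t. s * ln (t / (t + s))) has_real_derivative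
        s * (1 / (t / (t + s)) * (s / (t + s)^2))) (at t)"
      using t by (intro DERIV_cmult DERIV_chain2[where f = ln and g = "\<lambda>t. t / (t + s)"] DERIV_ln_divide) auto
    moreover have "s * (1 / (t / (t + s)) * (s / (t + s)^2)) = ?g t"
      using t by (simp add: power2_eq_square)
    ultimately show "((\<lambda>t. s * ln (t / (t + s))) has_real_derivative ?g t) (at t)" by simp
    show "0 \<le> ?g t" using t assms by auto
  next
    have "((\<lambda>t. s * ln (t / (t + s))) \<longlongrightarrow> s * ln 1) at_top"
    proof (intro tendsto_intros)
      have "LIM t at_top. t + s :> at_top"
        by (subst add.commute) (rule filterlim_tendsto_add_at_top[OF tendsto_const filterlim_ident])
      then have "((\<lambda>t. 1 - s / (t + s)) \<longlongrightarrow> 1 - 0) at_top"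
        by (intro tendsto_intros real_tendsto_divide_at_top[OF tendsto_const])
      moreover have "\<forall>\<^sub>F t in at_top. 1 - s / (t + s) = t / (t + s)"
        using eventually_gt_at_top[of 0] by eventually_elim (use assms in \<open>simp add: field_simps\<close>)
      ultimately show "((\<lambda>t. t / (t + s)) \<longlongrightarrow> 1) at_top"
        using Lim_transform_eventually by fastforce
    qed simp
    then show "((\<lambda>t. s * ln (t / (t + s))) \<longlongrightarrow> 0) at_top" by simp
  qed auto
  also have "0 - s * ln (2 * s / (2 * s + s)) = s * ln (3/2)"
  proof -
    have "2 * s / (2 * s + s) = 2/3" using assms by (simp add: field_simps)
    moreover have "ln (2/3) = - ln (3/2::real)" by (simp add: ln_div)
    ultimately show ?thesis by simp
  qed
  also have "ennreal (s / 2 * ln (3/2)) + ennreal (s * ln (3/2)) = ennreal (3/2 * ln (3/2) * s)"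
    using assms by (subst ennreal_plus[symmetric]) (auto simp: algebra_simps)
  finally show ?thesis .
qed

text \<open>This bounds the loss factor \<open>3/2 * ln (3/2)\<close> by 0.615, using
  \<open>(1 + x / n) ^ n \<le> exp x\<close> with \<open>x = 0.41\<close> and
  \<open>n = 20\<close>.\<close>

lemma ln_three_halves_le: "ln (3/2) \<le> (41/100 :: real)"
proof -
  have "3/2 \<le> (1 + (41/100) / real 20) ^ 20"
    by (simp add: power_divide)
  also have "\<dots> \<le> exp (41/100 :: real)"
    by (rule exp_ge_one_plus_x_over_n_power_n) auto
  finally have "ln (3/2) \<le> ln (exp (41/100 :: real))"
    by (subst ln_le_cancel_iff) auto
  then show ?thesis by simp
qed

section \<open>The second-price auction with a duplicate\<close>

text \<open>Members outside \<open>A\<close> are discarded by raising their \<open>G i\<close> to 1,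
  those in \<open>A\<close> are raised to \<open>H i\<close>; both only increase the
  probability.\<close>

lemma at_most_one_le_subset:
  assumes "finite B" "A \<subseteq> B" "\<And>i. i \<in> B \<Longrightarrow> 0 \<le> G i \<and> G i \<le> 1"
    and "\<And>i. i \<in> A \<Longrightarrow> G i \<le> H i \<and> H i \<le> 1"
  shows "at_most_one B G \<le> at_most_one A H"
proof -
  have "at_most_one B G \<le> at_most_one B (\<lambda>i. if i \<in> A then H i else 1)"
    using assms by (intro at_most_one_mono) auto
  also have "\<dots> = at_most_one A (\<lambda>i. if i \<in> A then H i else 1)"
    using assms by (intro at_most_one_restrict) auto
  also have "\<dots> = at_most_one A H"
    unfolding at_most_one_def
    by (intro arg_cong2[where f = "(+)"] sum.cong arg_cong2[where f = "(*)"] prod.cong) auto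
  finally show ?thesis .
qed

lemma real_distribution_cdf_bounds:
  assumes "real_distribution D"
  shows "0 \<le> cdf D t \<and> cdf D t \<le> 1"
proof -
  interpret real_distribution D by fact
  show ?thesis using cdf_nonneg cdf_bounded_prob by blast
qed

lemma real_distribution_cdf_mono:
  assumes "real_distribution D" "t \<le> t'"
  shows "cdf D t \<le> cdf D t'"
proof -
  interpret real_distribution D by fact
  show ?thesis using assms(2) by (rule cdf_nondecreasing)
qed

text \<open>Quasi-regularity makes \<open>v * (1 - F v) / F v\<close> weakly decreasing where
  \<open>F v > 0\<close>, so at \<open>t \<le> v\<close> it is at least its value at
  \<open>v\<close>; solving for \<open>F t\<close> gives the equal-revenue curve through
  \<open>(v, F v)\<close>.\<close>

lemma quasi_regular_cdf_le:
  assumes "real_distribution D" "quasi_regular D" "0 < t" "t \<le> v" "0 < cdf D v"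
  shows "cdf D t \<le> t / (t + v * (1 - cdf D v) / cdf D v)"
proof (cases "cdf D t = 0")
  case False
  then have pos: "0 < cdf D t" using real_distribution_cdf_bounds[OF assms(1), of t] by simp
  let ?a = "v * (1 - cdf D v) / cdf D v"
  have a: "0 \<le> ?a" using assms real_distribution_cdf_bounds[OF assms(1), of v] by auto
  have "- t * ((1 - cdf D t) / cdf D t) \<le> - v * ((1 - cdf D v) / cdf D v)"
    using assms pos unfolding quasi_regular_def by (elim mono_onD) auto
  then have "?a \<le> t * (1 - cdf D t) / cdf D t" by simp
  then have "?a * cdf D t \<le> t * (1 - cdf D t)" using pos by (simp add: pos_le_divide_eq)
  then have "cdf D t * (t + ?a) \<le> t" by (simp add: algebra_simps)
  then show ?thesis using a assms(3) by (simp add: pos_le_divide_eq)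
next
  case True
  then show ?thesis
    using assms real_distribution_cdf_bounds[OF assms(1), of v] by (simp add: add_nonneg_nonneg)
qed

lemma SPA_dup_eq_integral:
  assumes "\<And>i. real_distribution (F i)" "j < n"
  shows "SPA (Suc n) (F(n := F j))
    = (\<integral>\<^sup>+ t. indicator {0<..} t * ennreal (1 - at_most_one {..<Suc n} (\<lambda>i. cdf ((F(n := F j)) i) t)) \<partial>lborel)"
  using assms by (intro SPA_eq_integral) auto

text \<open>Transfers \<open>post_density_le_dup\<close> to actual distributions: dropping buyers
  outside \<open>A\<close> and passing to curves above the distribution functions only lowers the
  probability of two high values.\<close>

lemma post_density_le_second_price:
  assumes rd: "\<And>i. real_distribution (F i)" and A: "A \<subseteq> {..<n}" "j \<in> A" and t: "0 < t"
    and a: "\<And>i. i \<in> A \<Longrightarrow> 0 < a i \<and> a i \<le> a j"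
    and F: "\<And>i. i \<in> A \<Longrightarrow> cdf (F i) t \<le> t / (t + a i)"
  shows "post_density A a t \<le> 1 - at_most_one {..<Suc n} (\<lambda>i. cdf ((F(n := F j)) i) t)"
proof -
  let ?b = "\<lambda>i. if i = n then a j else a i"
  have fin: "finite A" using A finite_subset by blast
  have "post_density A a t \<le> 1 - at_most_one (insert n A) (\<lambda>i. t / (t + ?b i))"
    using A a t fin by (intro post_density_le_dup) auto
  moreover have "at_most_one {..<Suc n} (\<lambda>i. cdf ((F(n := F j)) i) t) \<le> at_most_one (insert n A) (\<lambda>i. t / (t + ?b i))"
  proof (rule at_most_one_le_subset)
    fix i assume i: "i \<in> insert n A"
    then have "0 < ?b i" using a A by auto
    then have "t / (t + ?b i) \<le> 1" using t by simp
    moreover have "cdf ((F(n := F j)) i) t \<le> t / (t + ?b i)" using i F A by auto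
    ultimately show "cdf ((F(n := F j)) i) t \<le> t / (t + ?b i) \<and> t / (t + ?b i) \<le> 1" by blast
  qed (use A rd real_distribution_cdf_bounds in auto)
  ultimately show ?thesis by simp
qed

text \<open>The hypothesis is used for a buyer \<open>j\<close> who is most likely to exceed the price \<open>t\<close>.\<close>

lemma anonymous_price_le_SPA_dup:
  assumes rd: "\<And>i. real_distribution (F i)" and qr: "\<And>i. i < n \<Longrightarrow> quasi_regular (F i)"
    and s: "0 \<le> s" "\<And>j. j < n \<Longrightarrow> SPA (Suc n) (F(n := F j)) \<le> ennreal s" and t: "0 < t"
  shows "t * (1 - (\<Prod>i<n. cdf (F i) t)) \<le> s"
\<comment> \<open>If buyer \<open>i\<close> is surely above \<open>t\<close>, no equal-revenue curve
  passes through its point at \<open>t\<close>. Duplicating \<open>i\<close> then gives two values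
  above every \<open>u < t\<close>, so the auction earns at least \<open>t\<close>.\<close>
proof (cases "\<exists>i<n. cdf (F i) t = 0")
  case True
  then obtain i where i: "i < n" "cdf (F i) t = 0" by blast
  have "ennreal t = (\<integral>\<^sup>+ u. indicator {0<..<t} u \<partial>lborel)"
    using t by simp
  also have "\<dots> \<le> SPA (Suc n) (F(n := F i))"
    unfolding SPA_dup_eq_integral[of F, OF rd i(1)]
  proof (rule nn_integral_mono)
    fix u :: real
    have "1 \<le> 1 - at_most_one {..<Suc n} (\<lambda>k. cdf ((F(n := F i)) k) u)" if "u < t"
    proof -
      have "cdf (F i) u = 0"
        using real_distribution_cdf_mono[OF rd, of u t i] real_distribution_cdf_bounds[OF rd, of i u] i that by simp
      then have "at_most_one {..<Suc n} (\<lambda>k. cdf ((F(n := F i)) k) u) \<le> at_most_one {i, n} (\<lambda>_. 0)"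
        using i rd real_distribution_cdf_bounds by (intro at_most_one_le_subset) auto
      also have "\<dots> = 0" using i by (simp add: at_most_one_insert)
      finally show ?thesis by simp
    qed
    then show "indicator {0<..<t} u \<le> indicator {0<..} u *
        ennreal (1 - at_most_one {..<Suc n} (\<lambda>k. cdf ((F(n := F i)) k) u))"
      by (auto simp: indicator_def)
  qed
  also have "\<dots> \<le> ennreal s" using s i by blast
  finally have "t \<le> s" using s by (simp add: ennreal_le_iff)
  moreover have "(\<Prod>i<n. cdf (F i) t) = 0" using i by (intro prod_zero) auto
  ultimately show ?thesis by (simp only:) simp
next
  case False
  \<comment> \<open>The parameter \<open>a i\<close> makes the curve meet the distribution function
    at the price: \<open>t / (t + a i) = cdf (F i) t\<close>. Buyers with
    \<open>cdf (F i) t = 1\<close> would get \<open>a i = 0\<close> and contribute only a factor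
    1.\<close>
  define A where "A = {i. i < n \<and> cdf (F i) t < 1}"
  define a where "a = (\<lambda>i. t * (1 - cdf (F i) t) / cdf (F i) t)"
  have A: "finite A" "A \<subseteq> {..<n}" by (auto simp: A_def)
  have Fpos: "0 < cdf (F i) t" if "i < n" for i
    using False that real_distribution_cdf_bounds[OF rd, of i t] by force
  have apos: "0 < a i" if "i \<in> A" for i
    using that Fpos t by (auto simp: a_def A_def intro!: divide_pos_pos mult_pos_pos)
  have Peq: "(\<Prod>i\<in>A. t / (t + a i)) = (\<Prod>i<n. cdf (F i) t)"
  proof -
    have "(\<Prod>i\<in>A. t / (t + a i)) = (\<Prod>i\<in>A. cdf (F i) t)"
    proof (rule prod.cong)
      fix i assume "i \<in> A"
      then have "0 < cdf (F i) t" using Fpos A by auto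
      then have "t + a i = t / cdf (F i) t" by (simp add: a_def field_simps)
      then show "t / (t + a i) = cdf (F i) t" using t by simp
    qed simp
    also have "\<dots> = (\<Prod>i<n. cdf (F i) t)"
      using A real_distribution_cdf_bounds[OF rd]
      by (intro prod.mono_neutral_left) (auto simp: A_def intro: antisym)
    finally show ?thesis .
  qed
  show ?thesis
  proof (cases "A = {}")
    case True
    then show ?thesis using Peq s by simp
  next
    case False
    have "Max (a ` A) \<in> a ` A" using A False by (intro Max_in) auto
    then obtain j where j: "j \<in> A" "a j = Max (a ` A)" by fastforce
    then have aj: "a i \<le> a j" if "i \<in> A" for i using that A by simp
    have "ennreal (t * (1 - (\<Prod>i\<in>A. t / (t + a i))))
        = (\<integral>\<^sup>+ u. indicator {0<..<t} u * ennreal (post_density A a u) \<partial>lborel)"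
      using A apos t by (subst nn_integral_post_density) auto
    also have "\<dots> \<le> SPA (Suc n) (F(n := F j))"
    proof -
      have "j < n" using j A by auto
      show ?thesis
        unfolding SPA_dup_eq_integral[of F, OF rd \<open>j < n\<close>]
      proof (rule nn_integral_mono)
        fix u :: real
        have "post_density A a u \<le> 1 - at_most_one {..<Suc n} (\<lambda>i. cdf ((F(n := F j)) i) u)" if "0 < u" "u < t"
        proof (rule post_density_le_second_price[OF rd A(2) j(1) \<open>0 < u\<close>])
          fix i assume i: "i \<in> A"
          show "0 < a i \<and> a i \<le> a j" using i apos aj by blast
          show "cdf (F i) u \<le> u / (u + a i)"
            unfolding a_def using i A that by (intro quasi_regular_cdf_le rd qr Fpos) auto
        qed
        then show "indicator {0<..<t} u * ennreal (post_density A a u)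
          \<le> indicator {0<..} u * ennreal (1 - at_most_one {..<Suc n} (\<lambda>i. cdf ((F(n := F j)) i) u))"
          by (auto simp: indicator_def intro!: ennreal_leI)
      qed
    qed
    also have "\<dots> \<le> ennreal s" using s j A by auto
    finally show ?thesis using s by (simp add: Peq ennreal_le_iff)
  qed
qed

text \<open>The duplicate \<open>j\<close> leaves last among the buyers with \<open>a j \<ge> \<rho>\<close>, where \<open>\<rho> \<le> s\<close> is the largest
  posted-price revenue \<open>r i\<close> from a single buyer. Truncating every \<open>a i\<close> at \<open>a j\<close> makes \<open>j\<close> dominant
  without losing any of the \<open>r i\<close>, and after \<open>j\<close> has left all remaining \<open>a i\<close> are below \<open>s\<close>.\<close>

lemma sum_excess_le_SPA_dup:
  assumes rd: "\<And>i. real_distribution (F i)" and qr: "\<And>i. i < n \<Longrightarrow> quasi_regular (F i)"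
    and s: "0 < s" "\<And>j. j < n \<Longrightarrow> SPA (Suc n) (F(n := F j)) \<le> ennreal s"
    and v: "\<And>i. i < n \<Longrightarrow> s < v i"
  shows "(\<Sum>i<n. (v i - s) * (1 - cdf (F i) (v i))) \<le> 1.615 * s"
proof -
  define S where "S = {i. i < n \<and> cdf (F i) (v i) < 1}"
  \<comment> \<open>\<open>a i\<close> is the parameter of the equal-revenue curve through buyer
    \<open>i\<close> at \<open>v i\<close>, and \<open>r i\<close> is the revenue from posting
    \<open>v i\<close> to this buyer alone.\<close>
  define a where "a = (\<lambda>i. v i * (1 - cdf (F i) (v i)) / cdf (F i) (v i))"
  define r where "r = (\<lambda>i. v i * (1 - cdf (F i) (v i)))"
  have S: "finite S" "S \<subseteq> {..<n}" by (auto simp: S_def)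
  note bounds = real_distribution_cdf_bounds[OF rd]
  have price: "t * (1 - (\<Prod>i<n. cdf (F i) t)) \<le> s" if "0 < t" for t
    using anonymous_price_le_SPA_dup[OF rd qr _ s(2) that] s(1) by simp
  have vpos: "0 < v i" if "i < n" for i using v[OF that] s by simp
  have prod_le: "(\<Prod>i<n. cdf (F i) t) \<le> (\<Prod>i\<in>A. cdf (F i) t)" if "A \<subseteq> {..<n}" for A t
    using that bounds by (intro prod_le_prod_subset) auto
  have r_le: "r i \<le> s" if "i < n" for i
  proof -
    have "r i \<le> v i * (1 - (\<Prod>k<n. cdf (F k) (v i)))"
      unfolding r_def using prod_le[of "{i}" "v i"] vpos[OF that] that by (intro mult_left_mono) auto
    also have "\<dots> \<le> s" using price vpos that by blast
    finally show ?thesis .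
  qed
  \<comment> \<open>A zero here would make \<open>r i = v i > s\<close>, against
    \<open>r_le\<close>.\<close>
  have Fpos: "0 < cdf (F i) (v i)" if "i < n" for i
  proof (rule ccontr)
    assume "\<not> 0 < cdf (F i) (v i)"
    then have "cdf (F i) (v i) = 0" using bounds[of i "v i"] by simp
    then show False using r_le[OF that] v[OF that] by (simp add: r_def)
  qed
  have apos: "0 < a i" if "i \<in> S" for i
    using that Fpos vpos by (auto simp: a_def S_def intro!: divide_pos_pos mult_pos_pos)
  have r_le_a: "r i \<le> a i" if "i \<in> S" for i
  proof -
    have i: "i < n" using that by (simp add: S_def)
    have "r i = a i * cdf (F i) (v i)" using Fpos[OF i] by (simp add: r_def a_def)
    also have "\<dots> \<le> a i * 1" using apos[OF that] bounds by (intro mult_left_mono) auto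
    finally show ?thesis by simp
  qed
  have tri: "cdf (F i) t \<le> t / (t + a i)" if "i \<in> S" "0 < t" "t \<le> v i" for i t
    unfolding a_def using that S by (intro quasi_regular_cdf_le rd qr Fpos) auto
  have sumS: "(\<Sum>i<n. (v i - s) * (1 - cdf (F i) (v i))) = (\<Sum>i\<in>S. r i * (1 - s / v i))"
  proof -
    have "(\<Sum>i<n. (v i - s) * (1 - cdf (F i) (v i))) = (\<Sum>i\<in>S. (v i - s) * (1 - cdf (F i) (v i)))"
      using S bounds by (intro sum.mono_neutral_right) (auto simp: S_def intro: antisym)
    also have "\<dots> = (\<Sum>i\<in>S. r i * (1 - s / v i))"
    proof (rule sum.cong)
      fix i assume "i \<in> S"
      then have "0 < v i" using vpos S by auto
      then show "(v i - s) * (1 - cdf (F i) (v i)) = r i * (1 - s / v i)" by (simp add: r_def field_simps)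
    qed simp
    finally show ?thesis .
  qed
  show ?thesis
  proof (cases "S = {}")
    case True
    then show ?thesis using sumS s by simp
  next
    case False
    define \<rho> where "\<rho> = Max (r ` S)"
    have r_le_rho: "r i \<le> \<rho>" if "i \<in> S" for i using that S by (simp add: \<rho>_def)
    have "\<rho> \<in> r ` S" unfolding \<rho>_def using S False by (intro Max_in) auto
    then obtain m where m: "m \<in> S" "r m = \<rho>" by blast
    have rho_le: "\<rho> \<le> s" using r_le[of m] m S by auto
    define J where "J = {i\<in>S. \<rho> \<le> a i}"
    have J: "finite J" "m \<in> J" using S m r_le_a[of m] by (auto simp: J_def)
    then have "Max (v ` J) \<in> v ` J" by (intro Max_in) auto
    then obtain j where j: "j \<in> J" "v j = Max (v ` J)" by fastforce
    then have vj: "v i \<le> v j" if "i \<in> J" for i using that J by simp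
    have jS: "j \<in> S" "\<rho> \<le> a j" "j < n" using j S by (auto simp: J_def)
    define b where "b = (\<lambda>i. min (a i) (a j))"
    have b: "0 < b i \<and> b i \<le> b j" if "i \<in> S" for i
      using apos[OF that] apos[OF jS(1)] by (simp add: b_def)
    have r_le_b: "r i \<le> b i" if "i \<in> S" for i
      using r_le_a[OF that] r_le_rho[OF that] jS by (simp add: b_def)
    have tri': "cdf (F i) t \<le> t / (t + b i)" if "i \<in> S" "0 < t" "t \<le> v i" for i t
    proof -
      have "t / (t + a i) \<le> t / (t + b i)"
        using b[OF that(1)] that by (intro divide_left_mono mult_pos_pos) (auto simp: b_def)
      then show ?thesis using tri[OF that] by simp
    qed
    \<comment> \<open>The anonymous-price bound survives keeping only the buyers in \<open>A\<close>
      and raising their distribution functions to the curves. It supplies the product hypothesis of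
      \<open>sum_le_nn_integral_post_density\<close> and of
      \<open>post_density_le_no_dup\<close>.\<close>
    have constr: "1 - s / t \<le> (\<Prod>k\<in>A. t / (t + b k))" if "0 < t" "A \<subseteq> S" "\<And>k. k \<in> A \<Longrightarrow> t \<le> v k" for A t
    proof -
      have "1 - (\<Prod>i<n. cdf (F i) t) \<le> s / t"
        using price[OF that(1)] that(1) by (simp add: pos_le_divide_eq mult.commute)
      moreover have "(\<Prod>i<n. cdf (F i) t) \<le> (\<Prod>k\<in>A. cdf (F k) t)"
        using that S by (intro prod_le) auto
      moreover have "\<dots> \<le> (\<Prod>k\<in>A. t / (t + b k))"
        using that bounds by (intro prod_mono) (auto intro!: tri')
      ultimately show ?thesis by linarith
    qed
    let ?D = "\<lambda>t. post_density {i\<in>S. t < v i} b t"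
    let ?T = "\<lambda>t. 1 - at_most_one {..<Suc n} (\<lambda>i. cdf ((F(n := F j)) i) t)"
    have T0: "0 \<le> ?T t" for t
      using at_most_one_le_1[of "{..<Suc n}" "\<lambda>i. cdf ((F(n := F j)) i) t"] bounds by auto
    \<comment> \<open>Before \<open>v j\<close> the duplicate is dominant. From
      \<open>v j > s\<close> on, nobody in \<open>J\<close> is left, so the remaining parameters are
      below \<open>\<rho> \<le> s\<close>, and the duplicate is ignored at cost
      \<open>no_dup_loss s t\<close>.\<close>
    have pointwise: "?D t \<le> ?T t + (if s \<le> t then no_dup_loss s t else 0)" if t: "0 < t" for t
    proof (cases "t < v j")
      case True
      have "?D t \<le> ?T t"
        using S jS b True tri' t by (intro post_density_le_second_price rd) auto
      then show ?thesis using no_dup_loss_nonneg[of s t] s t by auto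
    next
      case False
      then have "s \<le> t" using v[OF jS(3)] by simp
      have "?D t \<le> 1 - at_most_one {i\<in>S. t < v i} (\<lambda>i. t / (t + b i)) + no_dup_loss s t"
      proof (rule post_density_le_no_dup)
        fix i assume i: "i \<in> {i\<in>S. t < v i}"
        then have "\<not> \<rho> \<le> a i" using vj[of i] False by (auto simp: J_def)
        then have "b i \<le> s" using rho_le by (simp add: b_def)
        then show "0 < b i \<and> b i \<le> s" using b i by auto
      qed (use S s \<open>s \<le> t\<close> t in \<open>auto intro!: constr\<close>)
      moreover have "at_most_one {..<Suc n} (\<lambda>i. cdf ((F(n := F j)) i) t)
          \<le> at_most_one {i\<in>S. t < v i} (\<lambda>i. t / (t + b i))"
      proof (rule at_most_one_le_subset)
        fix i assume i: "i \<in> {i\<in>S. t < v i}"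
        then have "i < n" "t / (t + b i) \<le> 1" using S b[of i] t by auto
        then show "cdf ((F(n := F j)) i) t \<le> t / (t + b i) \<and> t / (t + b i) \<le> 1"
          using tri'[of i t] i t by simp
      qed (use S bounds in auto)
      ultimately show ?thesis using \<open>s \<le> t\<close> by simp
    qed
    note [measurable] = post_density_Collect_measurable[OF S(1)]
    have "ennreal (\<Sum>i\<in>S. r i * (1 - s / v i)) \<le> ennreal (\<Sum>i\<in>S. b i * (1 - s / v i))"
    proof (intro ennreal_leI sum_mono mult_right_mono r_le_b)
      fix i assume "i \<in> S"
      then have "s < v i" using v S by auto
      then show "0 \<le> 1 - s / v i" using s by simp
    qed
    also have "\<dots> \<le> (\<integral>\<^sup>+ t. indicator {0<..} t * ennreal (?D t) \<partial>lborel)"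
      using S s b vpos by (intro sum_le_nn_integral_post_density constr) auto
    also have "\<dots> \<le> (\<integral>\<^sup>+ t. indicator {0<..} t * ennreal (?T t)
        + indicator {s..} t * ennreal (no_dup_loss s t) \<partial>lborel)"
    proof (rule nn_integral_mono)
      fix t
      have "ennreal (?D t) \<le> ennreal (?T t) + (if s \<le> t then ennreal (no_dup_loss s t) else 0)" if "0 < t"
      proof -
        have "ennreal (?D t) \<le> ennreal (?T t + (if s \<le> t then no_dup_loss s t else 0))"
          using pointwise[OF that] by (rule ennreal_leI)
        also have "\<dots> = ennreal (?T t) + ennreal (if s \<le> t then no_dup_loss s t else 0)"
          using T0 no_dup_loss_nonneg[of s t] s that by (intro ennreal_plus) auto
        finally show ?thesis by auto
      qed
      then show "indicator {0<..} t * ennreal (?D t) \<le> indicator {0<..} t * ennreal (?T t)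
          + indicator {s..} t * ennreal (no_dup_loss s t)"
        using s by (auto simp: indicator_def split: if_splits)
    qed
    also have "\<dots> = (\<integral>\<^sup>+ t. indicator {0<..} t * ennreal (?T t) \<partial>lborel)
        + (\<integral>\<^sup>+ t. indicator {s..} t * ennreal (no_dup_loss s t) \<partial>lborel)"
    proof (rule nn_integral_add)
      have [measurable]: "cdf (F i) \<in> borel_measurable borel" for i
        using real_distribution_cdf_mono[OF rd] by (intro borel_measurable_mono monoI)
      have "(\<lambda>t. cdf ((F(n := F j)) i) t) \<in> borel_measurable borel" for i
        by (cases "i = n") auto
      then show "(\<lambda>t. indicator {0<..} t * ennreal (?T t)) \<in> borel_measurable lborel"
        unfolding at_most_one_def by measurable
    qed measurable
    also have "\<dots> \<le> ennreal s + ennreal (3/2 * ln (3/2) * s)"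
      using s(2)[OF jS(3)] unfolding SPA_dup_eq_integral[of F, OF rd jS(3)]
      by (intro add_mono nn_integral_no_dup_loss s(1))
    also have "\<dots> = ennreal (s + 3/2 * ln (3/2) * s)" using s by (intro ennreal_plus[symmetric]) auto
    finally have "(\<Sum>i\<in>S. r i * (1 - s / v i)) \<le> s + 3/2 * ln (3/2) * s"
      using s by (subst (asm) ennreal_le_iff) auto
    also have "\<dots> = (1 + 3/2 * ln (3/2)) * s" by (simp add: algebra_simps)
    also have "\<dots> \<le> 1.615 * s" using ln_three_halves_le s by (intro mult_right_mono) auto
    finally show ?thesis by (simp add: sumS)
  qed
qed

section \<open>A Lagrangian bound on truthful revenue\<close>

text \<open>Adding the two incentive constraints between \<open>b\<close> and \<open>v\<close>
  cancels the payments.\<close>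

lemma allocation_mono:
  fixes x p :: "real \<Rightarrow> real"
  assumes IC: "\<And>v b. 0 \<le> v \<Longrightarrow> 0 \<le> b \<Longrightarrow> v * x b - p b \<le> v * x v - p v"
    and "0 \<le> b" "b \<le> v"
  shows "x b \<le> x v"
proof (cases "b = v")
  case False
  have "(v - b) * x b \<le> (v - b) * x v"
    using IC[of v b] IC[of b v] assms(2,3) by (simp add: algebra_simps)
  then show ?thesis using assms(3) False by simp
qed simp

lemma nn_integral_split_Ico:
  fixes f :: "real \<Rightarrow> ennreal"
  assumes [measurable]: "f \<in> borel_measurable borel" and "a \<le> b" "b \<le> c"
  shows "(\<integral>\<^sup>+ s. indicator {a..<c} s * f s \<partial>lborel)
    = (\<integral>\<^sup>+ s. indicator {a..<b} s * f s \<partial>lborel) + (\<integral>\<^sup>+ s. indicator {b..<c} s * f s \<partial>lborel)"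
  using assms(2,3)
  by (subst nn_integral_add[symmetric]) (auto intro!: nn_integral_cong simp: indicator_def)

text \<open>Envelope inequality. On a grid of width \<open>h\<close>, truthfulness gives a utility
  gain of at least \<open>h * x a\<close> from \<open>a\<close> to the next point \<open>b\<close>,
  while monotonicity bounds the integral of \<open>x\<close> there by \<open>h * x b\<close>. The
  errors telescope to \<open>h * x v \<le> h\<close>.\<close>

lemma utility_ge_integral_allocation:
  fixes x p :: "real \<Rightarrow> real"
  assumes [measurable]: "x \<in> borel_measurable borel"
    and x: "\<And>v. 0 \<le> v \<Longrightarrow> 0 \<le> x v \<and> x v \<le> 1"
    and IC: "\<And>v b. 0 \<le> v \<Longrightarrow> 0 \<le> b \<Longrightarrow> v * x b - p b \<le> v * x v - p v"
    and IR: "\<And>v. 0 \<le> v \<Longrightarrow> 0 \<le> v * x v - p v"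
    and v: "0 \<le> v"
  shows "(\<integral>\<^sup>+ s. indicator {0..<v} s * ennreal (x s) \<partial>lborel) \<le> ennreal (v * x v - p v)"
proof (rule ennreal_le_epsilon)
  fix e :: real assume e: "0 < e"
  obtain N :: nat where N: "v / e < real N" using reals_Archimedean2 by blast
  have "0 < real N" using N v e by (smt (verit) divide_nonneg_pos)
  then have N0: "0 < N" by simp
  define h where "h = v / real N"
  have h: "0 \<le> h" "h \<le> e" using N N0 v e by (auto simp: h_def field_simps)
  have "(\<integral>\<^sup>+ s. indicator {0..<real k * h} s * ennreal (x s) \<partial>lborel)
      \<le> ennreal (real k * h * x (real k * h) - p (real k * h) + h * x (real k * h))" for k
  proof (induction k)
    case 0
    then show ?case by simp
  next
    case (Suc k)
    let ?a = "real k * h" and ?b = "real (Suc k) * h"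
    have ab: "0 \<le> ?a" "?a \<le> ?b" "?b - ?a = h" using h by (auto simp: algebra_simps)
    have b: "0 \<le> ?b" using ab by linarith
    have "(\<integral>\<^sup>+ s. indicator {0..<?b} s * ennreal (x s) \<partial>lborel)
      = (\<integral>\<^sup>+ s. indicator {0..<?a} s * ennreal (x s) \<partial>lborel)
        + (\<integral>\<^sup>+ s. indicator {?a..<?b} s * ennreal (x s) \<partial>lborel)"
      using ab by (intro nn_integral_split_Ico) auto
    also have "(\<integral>\<^sup>+ s. indicator {?a..<?b} s * ennreal (x s) \<partial>lborel)
        \<le> (\<integral>\<^sup>+ s. ennreal (x ?b) * indicator {?a..<?b} s \<partial>lborel)"
    proof (rule nn_integral_mono)
      fix s
      have "x s \<le> x ?b" if "?a \<le> s" "s < ?b"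
        using allocation_mono[OF IC, of s ?b] that ab by auto
      then show "indicator {?a..<?b} s * ennreal (x s) \<le> ennreal (x ?b) * indicator {?a..<?b} s"
        by (auto simp: indicator_def intro!: ennreal_leI)
    qed
    also have "\<dots> = ennreal (h * x ?b)"
      using ab h x[OF b] by (simp add: nn_integral_cmult ennreal_mult mult.commute)
    also have "(\<integral>\<^sup>+ s. indicator {0..<?a} s * ennreal (x s) \<partial>lborel) + ennreal (h * x ?b)
        \<le> ennreal (?a * x ?a - p ?a + h * x ?a) + ennreal (h * x ?b)"
      using Suc by (intro add_right_mono)
    also have "\<dots> = ennreal (?a * x ?a - p ?a + h * x ?a + h * x ?b)"
      using IR[OF ab(1)] x[OF ab(1)] x[OF b] h by (intro ennreal_plus[symmetric]) auto
    also have "\<dots> \<le> ennreal (?b * x ?b - p ?b + h * x ?b)"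
      using IC[OF b ab(1)] by (intro ennreal_leI) (simp add: algebra_simps)
    finally show ?case by (simp add: add_mono)
  qed
  from this[of N] have "(\<integral>\<^sup>+ s. indicator {0..<v} s * ennreal (x s) \<partial>lborel)
      \<le> ennreal (v * x v - p v + h * x v)"
    using N0 by (simp add: h_def)
  also have "\<dots> = ennreal (v * x v - p v) + ennreal (h * x v)"
    using IR[OF v] x[OF v] h by (intro ennreal_plus) auto
  also have "ennreal (h * x v) \<le> ennreal e"
    using mult_mono[of h e "x v" 1] x[OF v] h e by (intro ennreal_leI) auto
  finally show "(\<integral>\<^sup>+ s. indicator {0..<v} s * ennreal (x s) \<partial>lborel) \<le> ennreal (v * x v - p v) + ennreal e"
    by (simp add: add_left_mono)
qed

text \<open>The payment is \<open>v * x v\<close>, the integral of the constant \<open>x v\<close>,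
  minus the utility, to which the envelope inequality applies.\<close>

lemma payment_le_threshold_integral:
  fixes x p :: "real \<Rightarrow> real"
  assumes [measurable]: "x \<in> borel_measurable borel"
    and x: "\<And>v. 0 \<le> v \<Longrightarrow> 0 \<le> x v \<and> x v \<le> 1"
    and IC: "\<And>v b. 0 \<le> v \<Longrightarrow> 0 \<le> b \<Longrightarrow> v * x b - p b \<le> v * x v - p v"
    and IR: "\<And>v. 0 \<le> v \<Longrightarrow> 0 \<le> v * x v - p v"
    and v: "0 \<le> v"
  shows "ennreal (p v) \<le> (\<integral>\<^sup>+ s. indicator {0..<v} s * ennreal (x v - x s) \<partial>lborel)"
proof -
  let ?I = "\<integral>\<^sup>+ s. indicator {0..<v} s * ennreal (x v - x s) \<partial>lborel"
  let ?J = "\<integral>\<^sup>+ s. indicator {0..<v} s * ennreal (x s) \<partial>lborel"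
  have J: "?J \<le> ennreal (v * x v - p v)"
    using assms by (intro utility_ge_integral_allocation) auto
  have "?I + ?J = (\<integral>\<^sup>+ s. indicator {0..<v} s * ennreal (x v - x s) + indicator {0..<v} s * ennreal (x s) \<partial>lborel)"
    by (intro nn_integral_add[symmetric]) auto
  also have "\<dots> = (\<integral>\<^sup>+ s. ennreal (x v) * indicator {0..<v} s \<partial>lborel)"
  proof (rule nn_integral_cong)
    fix s
    have "ennreal (x v - x s) + ennreal (x s) = ennreal (x v)" if "0 \<le> s" "s < v"
      using allocation_mono[OF IC, of s v] that x[of s] by (subst ennreal_plus[symmetric]) auto
    then show "indicator {0..<v} s * ennreal (x v - x s) + indicator {0..<v} s * ennreal (x s)
        = ennreal (x v) * indicator {0..<v} s"
      by (auto simp: indicator_def)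
  qed
  also have "\<dots> = ennreal (v * x v)"
    using v x[OF v] by (simp add: nn_integral_cmult ennreal_mult mult.commute)
  finally have IJ: "?I + ?J = ennreal (v * x v)" .
  show ?thesis
  proof (cases "p v \<le> 0")
    case False
    have "ennreal (p v) + ennreal (v * x v - p v) = ennreal (v * x v)"
      using False IR[OF v] by (subst ennreal_plus[symmetric]) auto
    also have "\<dots> \<le> ?I + ennreal (v * x v - p v)"
      unfolding IJ[symmetric] using J by (rule add_left_mono)
    finally show ?thesis by (simp add: ennreal_add_left_cancel_le add.commute[of _ "ennreal (v * x v - p v)"])
  qed (simp add: ennreal_neg)
qed

text \<open>A truthful mechanism for one buyer is a mixture of posted prices: the level \<open>y\<close> of the
  allocation rule corresponds to the price at which \<open>x\<close> exceeds \<open>y\<close>.\<close>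

lemma single_buyer_revenue_le:
  fixes x p :: "real \<Rightarrow> real"
  assumes D: "value_dist D"
    and [measurable]: "x \<in> borel_measurable borel" "p \<in> borel_measurable borel"
    and x: "\<And>v. 0 \<le> v \<Longrightarrow> 0 \<le> x v \<and> x v \<le> 1"
    and IC: "\<And>v b. 0 \<le> v \<Longrightarrow> 0 \<le> b \<Longrightarrow> v * x b - p b \<le> v * x v - p v"
    and IR: "\<And>v. 0 \<le> v \<Longrightarrow> 0 \<le> v * x v - p v"
    and l: "0 \<le> l" and K: "0 \<le> K" "\<And>v. l < v \<Longrightarrow> (v - l) * measure D {v..} \<le> K"
  shows "(\<integral>\<^sup>+ v. ennreal (p v) \<partial>D) \<le> ennreal l * (\<integral>\<^sup>+ v. ennreal (x v) \<partial>D) + ennreal K"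
proof -
  interpret D: real_distribution D using D by (simp add: value_dist_def)
  have nonneg: "AE v in D. 0 \<le> v" using D by (simp add: value_dist_def)
  have sD [measurable_cong]: "sets D = sets borel" by simp
  interpret ls: pair_sigma_finite D lborel ..
  have mono: "s < v" if "0 \<le> s" "0 \<le> v" "x s < x v" for s v
    using allocation_mono[OF IC, of v s] that by (meson linorder_not_less)
  \<comment> \<open>\<open>?g\<close> marks triples with \<open>x s < y < x v\<close>. Integrating
    over \<open>y\<close> first recovers \<open>x v - x s\<close>; integrating over \<open>s\<close>
    first gives the length of \<open>L y\<close>, the price of level \<open>y\<close>, on the set
    \<open>U y\<close> of types buying at that level.\<close>
  let ?g = "\<lambda>v s y. if 0 \<le> v \<and> 0 \<le> s \<and> x s < y \<and> y < x v then 1 else 0 :: ennreal"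
  define L where "L = (\<lambda>y. {s. 0 \<le> s \<and> x s < y})"
  define U where "U = (\<lambda>y. {v. 0 \<le> v \<and> y < x v})"
  have [measurable]: "L y \<in> sets borel" "U y \<in> sets borel" for y
    unfolding L_def U_def by measurable
  have "(\<integral>\<^sup>+ v. ennreal (p v) \<partial>D) \<le> (\<integral>\<^sup>+ v. (\<integral>\<^sup>+ s. (\<integral>\<^sup>+ y. ?g v s y \<partial>lborel) \<partial>lborel) \<partial>D)"
  proof (rule nn_integral_mono_AE)
    show "AE v in D. ennreal (p v) \<le> (\<integral>\<^sup>+ s. (\<integral>\<^sup>+ y. ?g v s y \<partial>lborel) \<partial>lborel)"
      using nonneg
    proof eventually_elim
      case (elim v)
      have "ennreal (p v) \<le> (\<integral>\<^sup>+ s. indicator {0..<v} s * ennreal (x v - x s) \<partial>lborel)"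
        using x IC IR elim by (intro payment_le_threshold_integral) auto
      also have "\<dots> \<le> (\<integral>\<^sup>+ s. (\<integral>\<^sup>+ y. ?g v s y \<partial>lborel) \<partial>lborel)"
      proof (rule nn_integral_mono)
        fix s
        have "ennreal (x v - x s) \<le> (\<integral>\<^sup>+ y. ?g v s y \<partial>lborel)" if "0 \<le> s" "s < v"
        proof -
          have "ennreal (x v - x s) = (\<integral>\<^sup>+ y. indicator {x s<..<x v} y \<partial>lborel)"
            using allocation_mono[OF IC, of s v] that by simp
          also have "\<dots> \<le> (\<integral>\<^sup>+ y. ?g v s y \<partial>lborel)"
            using that elim by (intro nn_integral_mono) (auto simp: indicator_def)
          finally show ?thesis .
        qed
        then show "indicator {0..<v} s * ennreal (x v - x s) \<le> (\<integral>\<^sup>+ y. ?g v s y \<partial>lborel)"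
          by (auto simp: indicator_def)
      qed
      finally show ?case .
    qed
  qed
  also have "\<dots> = (\<integral>\<^sup>+ v. (\<integral>\<^sup>+ y. (\<integral>\<^sup>+ s. ?g v s y \<partial>lborel) \<partial>lborel) \<partial>D)"
    by (intro nn_integral_cong lborel_pair.Fubini') measurable
  also have "\<dots> = (\<integral>\<^sup>+ v. (\<integral>\<^sup>+ y. indicator (U y) v * emeasure lborel (L y) \<partial>lborel) \<partial>D)"
  proof (intro nn_integral_cong)
    fix v y
    have "(\<integral>\<^sup>+ s. ?g v s y \<partial>lborel) = (\<integral>\<^sup>+ s. indicator (U y) v * indicator (L y) s \<partial>lborel)"
      by (intro nn_integral_cong) (auto simp: L_def U_def indicator_def)
    then show "(\<integral>\<^sup>+ s. ?g v s y \<partial>lborel) = indicator (U y) v * emeasure lborel (L y)"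
      by (simp add: nn_integral_cmult)
  qed
  also have "\<dots> = (\<integral>\<^sup>+ y. (\<integral>\<^sup>+ v. indicator (U y) v * emeasure lborel (L y) \<partial>D) \<partial>lborel)"
  proof (rule ls.Fubini'[symmetric])
    have L: "emeasure lborel (L y) = (\<integral>\<^sup>+ s. (if 0 \<le> s \<and> x s < y then 1 else 0) \<partial>lborel)" for y
    proof -
      have "(\<integral>\<^sup>+ s. indicator (L y) s \<partial>lborel) = (\<integral>\<^sup>+ s. (if 0 \<le> s \<and> x s < y then 1 else 0) \<partial>lborel)"
        by (intro nn_integral_cong) (auto simp: L_def indicator_def)
      then show ?thesis by simp
    qed
    have U: "indicator (U y) v = (if 0 \<le> v \<and> y < x v then 1 else 0 :: ennreal)" for y v
      by (simp add: U_def indicator_def)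
    show "(\<lambda>(v, y). indicator (U y) v * emeasure lborel (L y)) \<in> borel_measurable (D \<Otimes>\<^sub>M lborel)"
      unfolding L U by measurable
  qed
  also have "\<dots> = (\<integral>\<^sup>+ y. emeasure D (U y) * emeasure lborel (L y) \<partial>lborel)"
    by (intro nn_integral_cong) (subst nn_integral_multc, auto)
  also have "\<dots> \<le> (\<integral>\<^sup>+ y. ennreal l * (indicator {0<..} y * emeasure D {v \<in> space D. y < x v})
      + ennreal K * indicator {0<..<1} y \<partial>lborel)"
  proof (rule nn_integral_mono)
    fix y
    show "emeasure D (U y) * emeasure lborel (L y) \<le> ennreal l * (indicator {0<..} y * emeasure D {v \<in> space D. y < x v})
      + ennreal K * indicator {0<..<1} y"
    proof (cases "U y = {} \<or> L y = {}")
      case True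
      then show ?thesis by auto
    next
      case False
      then obtain u w where uw: "u \<in> U y" "w \<in> L y" by blast
      then have y: "0 < y" "y < 1" using x[of u] x[of w] by (auto simp: L_def U_def)
      \<comment> \<open>By \<open>mono\<close>, types in \<open>L y\<close> lie below those in
        \<open>U y\<close>, so the length \<open>\<tau>\<close> of \<open>L y\<close> is a price
        that every type in \<open>U y\<close> can afford.\<close>
      have sub: "L y \<subseteq> {0..v}" if "v \<in> U y" for v
        using that mono[of _ v] by (force simp: L_def U_def)
      have "emeasure lborel (L y) \<le> ennreal u"
        using emeasure_mono[OF sub[OF uw(1)], of lborel] uw(1) by (auto simp: U_def)
      then obtain \<tau> where \<tau>: "emeasure lborel (L y) = ennreal \<tau>" "0 \<le> \<tau>"
        by (cases "emeasure lborel (L y)") (auto simp: top_unique)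
      have ge: "\<tau> \<le> v" if "v \<in> U y" for v
        using emeasure_mono[OF sub[OF that], of lborel] that \<tau> by (auto simp: U_def ennreal_le_iff)
      have m: "measure D (U y) \<le> measure D {\<tau>..}"
        using ge by (intro D.finite_measure_mono) auto
      have "\<tau> * measure D (U y) \<le> l * measure D (U y) + K"
      proof (cases "l < \<tau>")
        case True
        have "(\<tau> - l) * measure D (U y) \<le> (\<tau> - l) * measure D {\<tau>..}"
          using True m by (intro mult_left_mono) auto
        also have "\<dots> \<le> K" using K True by blast
        finally show ?thesis by (simp add: algebra_simps)
      next
        case False
        then show ?thesis using K mult_right_mono[of \<tau> l "measure D (U y)"] by simp
      qed
      then have "emeasure D (U y) * emeasure lborel (L y) \<le> ennreal (l * measure D (U y) + K)"
        using \<tau> by (simp add: D.emeasure_eq_measure ennreal_mult[symmetric] mult.commute ennreal_leI)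
      also have "\<dots> = ennreal l * emeasure D (U y) + ennreal K"
        using l K by (simp add: D.emeasure_eq_measure ennreal_mult ennreal_plus)
      also have "\<dots> \<le> ennreal l * emeasure D {v \<in> space D. y < x v} + ennreal K"
        by (intro add_right_mono mult_left_mono emeasure_mono) (auto simp: U_def)
      finally show ?thesis using y by simp
    qed
  qed
  also have "\<dots> = ennreal l * (\<integral>\<^sup>+ y. indicator {0<..} y * emeasure D {v \<in> space D. y < x v} \<partial>lborel) + ennreal K"
  proof -
    have E: "emeasure D {v \<in> space D. y < x v} = (\<integral>\<^sup>+ v. (if y < x v then 1 else 0) \<partial>D)" for y
    proof -
      have "(\<integral>\<^sup>+ v. indicator {v \<in> space D. y < x v} v \<partial>D) = (\<integral>\<^sup>+ v. (if y < x v then 1 else 0) \<partial>D)"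
        by (intro nn_integral_cong) (auto simp: indicator_def)
      then show ?thesis by simp
    qed
    have [measurable]: "(\<lambda>y. emeasure D {v \<in> space D. y < x v}) \<in> borel_measurable borel"
      unfolding E by measurable
    show ?thesis by (simp add: nn_integral_add nn_integral_cmult)
  qed
  also have "\<dots> = ennreal l * (\<integral>\<^sup>+ v. ennreal (x v) \<partial>D) + ennreal K"
    by (subst nn_integral_layer_cake[OF D.sigma_finite_measure_axioms]) auto
  finally show ?thesis .
qed

section \<open>From one buyer to the optimal mechanism\<close>

lemma AE_PiM_nonneg:
  assumes "\<And>i. value_dist (F i)" "finite I"
  shows "AE w in PiM I F. w \<in> (\<Pi>\<^sub>E i\<in>I. {0..})"
proof -
  have rd: "real_distribution (F i)" for i using assms(1) by (simp add: value_dist_def)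
  interpret finite_product_prob_space F I
    by (rule finite_product_prob_space_real_distribution[OF rd assms(2)])
  have "AE w in PiM I F. \<forall>i\<in>I. 0 \<le> w i"
    using assms by (intro AE_finite_allI AE_component) (auto simp: value_dist_def)
  moreover have "AE w in PiM I F. w \<in> space (PiM I F)" by (rule AE_space)
  ultimately show ?thesis
    by eventually_elim (auto simp: space_PiM PiE_iff)
qed

text \<open>Weak duality: \<open>l\<close> prices the constraint that only one item is sold, and
  \<open>K i\<close> bounds the profit from posting to buyer \<open>i\<close> a price above
  \<open>l\<close> when the item costs \<open>l\<close>. Buyer \<open>i\<close> pays at most
  \<open>l\<close> times its winning probability plus \<open>K i\<close> in expectation, and winning
  probabilities sum to at most 1.\<close>

lemma BOM_le:
  assumes vd: "\<And>i. value_dist (F i)" and l: "0 \<le> l"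
    and K: "\<And>i. i < n \<Longrightarrow> 0 \<le> K i"
      "\<And>i v. i < n \<Longrightarrow> l < v \<Longrightarrow> (v - l) * measure (F i) {v..} \<le> K i"
  shows "BOM n F \<le> ennreal (l + (\<Sum>i<n. K i))"
  unfolding BOM_def
proof (rule SUP_least, clarify)
  fix x p assume fe: "feasible n x p" and ic: "DSIC n x p" and ir: "IR n x p"
  have rd: "real_distribution (F i)" for i using vd by (simp add: value_dist_def)
  let ?P = "PiM {..<n} F"
  interpret P: finite_product_prob_space F "{..<n}"
    by (rule finite_product_prob_space_real_distribution[OF rd]) simp
  have sF [measurable_cong]: "sets (F i) = sets borel" for i using rd by (simp add: sets_real_distribution)
  have [measurable]: "x i \<in> borel_measurable ?P" "p i \<in> borel_measurable ?P" if "i < n" for i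
    using fe that measurable_cong_sets[OF sets_PiM_real_distribution[OF rd] refl]
    by (auto simp: feasible_def)
  have AEn: "AE v in ?P. v \<in> value_profiles n"
    unfolding value_profiles_def using vd by (intro AE_PiM_nonneg) auto
  have single: "(\<integral>\<^sup>+ v. ennreal (p i v) \<partial>?P) \<le> ennreal l * (\<integral>\<^sup>+ v. ennreal (x i v) \<partial>?P) + ennreal (K i)"
    if i: "i < n" for i
  proof -
    let ?I = "{..<n} - {i}"
    have ins: "insert i ?I = {..<n}" "insert i {..<n} = {..<n}" using i by auto
    interpret Q: finite_product_prob_space F ?I
      by (rule finite_product_prob_space_real_distribution[OF rd]) simp
    have upd [measurable]: "(\<lambda>y. w(i := y)) \<in> measurable borel ?P" if "w \<in> space (PiM ?I F)" for w
    proof -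
      have "(\<lambda>y. w(i := y)) \<in> measurable (F i) (PiM (insert i ?I) F)"
        using that by (intro measurable_component_update) auto
      then show ?thesis unfolding ins(1) by (simp add: measurable_cong_sets[OF sF refl])
    qed
    have "(\<integral>\<^sup>+ v. ennreal (p i v) \<partial>?P) = (\<integral>\<^sup>+ w. (\<integral>\<^sup>+ y. ennreal (p i (w(i := y))) \<partial>F i) \<partial>PiM ?I F)"
      using i P.product_nn_integral_insert[of ?I i "\<lambda>v. ennreal (p i v)"] by (simp add: ins)
    also have "\<dots> \<le> (\<integral>\<^sup>+ w. ennreal l * (\<integral>\<^sup>+ y. ennreal (x i (w(i := y))) \<partial>F i) + ennreal (K i) \<partial>PiM ?I F)"
    \<comment> \<open>For almost all fixed values \<open>w\<close> of the others,
      \<open>DSIC\<close> and \<open>IR\<close> leave a truthful one-buyer mechanism for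
      \<open>i\<close>.\<close>
    proof (rule nn_integral_mono_AE)
      show "AE w in PiM ?I F. (\<integral>\<^sup>+ y. ennreal (p i (w(i := y))) \<partial>F i)
          \<le> ennreal l * (\<integral>\<^sup>+ y. ennreal (x i (w(i := y))) \<partial>F i) + ennreal (K i)"
        using AE_PiM_nonneg[of F ?I, OF vd finite_Diff[OF finite_lessThan]] AE_space
      proof eventually_elim
        fix w assume w: "w \<in> (\<Pi>\<^sub>E i\<in>?I. {0..})" and sp: "w \<in> space (PiM ?I F)"
        have prof: "w(i := y) \<in> value_profiles n" if "0 \<le> y" for y
          using PiE_fun_upd[of y "\<lambda>_. {0..}" i w ?I] w that by (simp add: value_profiles_def ins)
        note [measurable] = upd[OF sp]
        show "(\<integral>\<^sup>+ y. ennreal (p i (w(i := y))) \<partial>F i)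
          \<le> ennreal l * (\<integral>\<^sup>+ y. ennreal (x i (w(i := y))) \<partial>F i) + ennreal (K i)"
        proof (rule single_buyer_revenue_le[OF vd])
          show "(\<lambda>y. x i (w(i := y))) \<in> borel_measurable borel"
            "(\<lambda>y. p i (w(i := y))) \<in> borel_measurable borel"
            using i by (auto intro: measurable_compose[OF upd[OF sp]])
          show "0 \<le> x i (w(i := y)) \<and> x i (w(i := y)) \<le> 1" if "0 \<le> y" for y
            using fe prof[OF that] i by (auto simp: feasible_def)
          show "y * x i (w(i := b)) - p i (w(i := b)) \<le> y * x i (w(i := y)) - p i (w(i := y))"
            if "0 \<le> y" "0 \<le> b" for y b
            using ic prof[OF that(1)] i that(2) unfolding DSIC_def by fastforce
          show "0 \<le> y * x i (w(i := y)) - p i (w(i := y))" if "0 \<le> y" for y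
            using ir prof[OF that] i unfolding IR_def by fastforce
        qed (use l K i in auto)
      qed
    qed
    also have "\<dots> = ennreal l * (\<integral>\<^sup>+ w. (\<integral>\<^sup>+ y. ennreal (x i (w(i := y))) \<partial>F i) \<partial>PiM ?I F) + ennreal (K i)"
    proof -
      have "(\<lambda>(w, y). w(i := y)) \<in> measurable (PiM ?I F \<Otimes>\<^sub>M F i) (PiM (insert i ?I) F)"
        by (rule measurable_add_dim)
      then have [measurable]: "(\<lambda>(w, y). w(i := y)) \<in> measurable (PiM ?I F \<Otimes>\<^sub>M F i) ?P"
        by (simp add: ins)
      have "(\<lambda>z. ennreal (x i (case z of (w, y) \<Rightarrow> w(i := y)))) \<in> borel_measurable (PiM ?I F \<Otimes>\<^sub>M F i)"
        using i by measurable
      then have "(\<lambda>w. \<integral>\<^sup>+ y. ennreal (x i (w(i := y))) \<partial>F i) \<in> borel_measurable (PiM ?I F)"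
        by (intro P.M.borel_measurable_nn_integral) (simp add: case_prod_beta)
      then show ?thesis
        by (subst nn_integral_add) (auto simp: nn_integral_cmult Q.P.emeasure_space_1)
    qed
    also have "(\<integral>\<^sup>+ w. (\<integral>\<^sup>+ y. ennreal (x i (w(i := y))) \<partial>F i) \<partial>PiM ?I F) = (\<integral>\<^sup>+ v. ennreal (x i v) \<partial>?P)"
      using i P.product_nn_integral_insert[of ?I i "\<lambda>v. ennreal (x i v)"] by (simp add: ins)
    finally show ?thesis .
  qed
  have "(\<integral>\<^sup>+ v. ennreal (\<Sum>i<n. p i v) \<partial>?P) = (\<integral>\<^sup>+ v. (\<Sum>i<n. ennreal (p i v)) \<partial>?P)"
    by (rule nn_integral_cong_AE, use AEn in eventually_elim)
       (use fe in \<open>auto simp: feasible_def intro!: sum_ennreal[symmetric]\<close>)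
  also have "\<dots> = (\<Sum>i<n. \<integral>\<^sup>+ v. ennreal (p i v) \<partial>?P)"
    by (intro nn_integral_sum) auto
  also have "\<dots> \<le> (\<Sum>i<n. ennreal l * (\<integral>\<^sup>+ v. ennreal (x i v) \<partial>?P) + ennreal (K i))"
    by (intro sum_mono single) auto
  also have "\<dots> = ennreal l * (\<Sum>i<n. \<integral>\<^sup>+ v. ennreal (x i v) \<partial>?P) + ennreal (\<Sum>i<n. K i)"
  proof -
    have "(\<Sum>i<n. ennreal (K i)) = ennreal (\<Sum>i<n. K i)" using K by (intro sum_ennreal) auto
    then show ?thesis by (simp add: sum.distrib sum_distrib_left)
  qed
  also have "(\<Sum>i<n. \<integral>\<^sup>+ v. ennreal (x i v) \<partial>?P) = (\<integral>\<^sup>+ v. (\<Sum>i<n. ennreal (x i v)) \<partial>?P)"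
    by (intro nn_integral_sum[symmetric]) auto
  also have "\<dots> \<le> (\<integral>\<^sup>+ v. 1 \<partial>?P)"
  proof (rule nn_integral_mono_AE, use AEn in eventually_elim)
    fix v assume v: "v \<in> value_profiles n"
    have "(\<Sum>i<n. ennreal (x i v)) = ennreal (\<Sum>i<n. x i v)"
      using fe v by (intro sum_ennreal) (auto simp: feasible_def)
    also have "\<dots> \<le> ennreal 1" using fe v by (intro ennreal_leI) (auto simp: feasible_def)
    finally show "(\<Sum>i<n. ennreal (x i v)) \<le> 1" by simp
  qed
  also have "\<dots> = 1" using P.P.emeasure_space_1 by simp
  also have "ennreal l * 1 + ennreal (\<Sum>i<n. K i) = ennreal (l + (\<Sum>i<n. K i))"
  proof -
    have "0 \<le> (\<Sum>i<n. K i)" using K by (intro sum_nonneg) auto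
    then show ?thesis using l by simp
  qed
  finally show "(\<integral>\<^sup>+ v. ennreal (\<Sum>i<n. p i v) \<partial>?P) \<le> ennreal (l + (\<Sum>i<n. K i))"
    by (simp add: add_right_mono mult_left_mono)
qed

text \<open>The Lagrangian price \<open>l = s\<close> contributes 1 to the factor, the best excess
  profits contribute 1.615 by \<open>sum_excess_le_SPA_dup\<close>.\<close>

lemma BOM_le_of_SPA_dup_le:
  assumes vd: "\<And>i. value_dist (F i)" and qr: "\<And>i. i < n \<Longrightarrow> quasi_regular (F i)"
    and s: "0 < s" "\<And>j. j < n \<Longrightarrow> SPA (Suc n) (F(n := F j)) \<le> ennreal s"
  shows "BOM n F \<le> ennreal (2.615 * s)"
proof -
  have rd: "real_distribution (F i)" for i using vd by (simp add: value_dist_def)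
  note bounds = real_distribution_cdf_bounds[OF rd]
  let ?W = "\<lambda>i v. (v - s) * (1 - cdf (F i) v)"
  have sum_le: "(\<Sum>i<n. ?W i (v i)) \<le> 1.615 * s" if "\<And>i. i < n \<Longrightarrow> s < v i" for v
    using sum_excess_le_SPA_dup[OF rd qr s(1) s(2) that] by simp
  have W0: "0 \<le> ?W i v" if "s < v" for i v using that bounds[of i v] by simp
  have W_le: "?W i v \<le> 1.615 * s" if i: "i < n" and v: "s < v" for i v
  proof -
    let ?v = "\<lambda>k. if k = i then v else s + 1"
    have "?W i (?v i) \<le> (\<Sum>k<n. ?W k (?v k))"
      using i v by (intro member_le_sum W0) auto
    also have "\<dots> \<le> 1.615 * s" using v by (intro sum_le) auto
    finally show ?thesis by simp
  qed
  define K where "K = (\<lambda>i. SUP v\<in>{s<..}. ?W i v)"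
  have bdd: "bdd_above (?W i ` {s<..})" if "i < n" for i
    using W_le[OF that] by (intro bdd_aboveI[of _ "1.615 * s"]) auto
  have W_K: "?W i v \<le> K i" if "i < n" "s < v" for i v
    unfolding K_def using that bdd by (intro cSUP_upper) auto
  have K0: "0 \<le> K i" if "i < n" for i
    using W_K[OF that, of "s + 1"] W0[of "s + 1" i] by simp
  have sumK: "(\<Sum>i<n. K i) \<le> 1.615 * s"
  proof (rule field_le_epsilon)
    fix e :: real assume e: "0 < e"
    \<comment> \<open>Prices within \<open>d\<close> of each supremum are chosen for all buyers at
      once, so that \<open>sum_le\<close> applies; the total slack \<open>n * d\<close> is at most
      \<open>e\<close>, also for \<open>n = 0\<close>.\<close>
    define d where "d = e / (real n + 1)"
    have d: "0 < d" using e by (simp add: d_def)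
    have "\<exists>v. s < v \<and> K i - d < ?W i v" if "i < n" for i
      using less_cSUP_iff[OF _ bdd[OF that], of "K i - d"] d by (auto simp: K_def)
    then obtain v where v: "\<And>i. i < n \<Longrightarrow> s < v i \<and> K i - d < ?W i (v i)" by metis
    have "(\<Sum>i<n. K i) \<le> (\<Sum>i<n. ?W i (v i) + d)" using v by (intro sum_mono) force
    also have "\<dots> = (\<Sum>i<n. ?W i (v i)) + real n * d" by (simp add: sum.distrib)
    also have "\<dots> \<le> 1.615 * s + e"
      using v e by (intro add_mono sum_le) (auto simp: d_def field_simps)
    finally show "(\<Sum>i<n. K i) \<le> 1.615 * s + e" .
  qed
  have "BOM n F \<le> ennreal (s + (\<Sum>i<n. K i))"
  proof (rule BOM_le)
    fix i v assume i: "i < n" and v: "s < v"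
    interpret real_distribution "F i" by (rule rd)
    let ?m = "measure (F i) {v..}"
    \<comment> \<open>\<open>BOM_le\<close> asks for the probability of values at least
      \<open>v\<close>, but \<open>?W\<close> counts only strictly larger ones. An atom at
      \<open>v\<close> separates the two, so \<open>v\<close> is approached by prices
      \<open>u\<close> from the left.\<close>
    have K_ge: "(u - s) * ?m \<le> K i" if "s < u" "u < v" for u
    proof -
      have "?m \<le> measure (F i) {u<..}" using that by (intro finite_measure_mono) auto
      also have "{u<..} = space (F i) - {..u}" by auto
      also have "measure (F i) (space (F i) - {..u}) = 1 - cdf (F i) u"
        by (subst prob_compl) (auto simp: cdf_def)
      finally have "(u - s) * ?m \<le> ?W i u" using that by (intro mult_left_mono) auto
      also have "\<dots> \<le> K i" using W_K i that by blast
      finally show ?thesis .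
    qed
    have lim: "((\<lambda>u. (u - s) * ?m) \<longlongrightarrow> (v - s) * ?m) (at_left v)"
      by (intro tendsto_intros)
    show "(v - s) * ?m \<le> K i"
    proof (rule tendsto_upperbound[OF lim])
      show "\<forall>\<^sub>F u in at_left v. (u - s) * ?m \<le> K i"
        using eventually_at_left_real[OF v] by eventually_elim (auto intro: K_ge)
    qed simp
  qed (use s K0 vd in auto)
  also have "\<dots> \<le> ennreal (2.615 * s)" using sumK by (intro ennreal_leI) simp
  finally show ?thesis .
qed

section \<open>The lower bound for quasi-regular distributions\<close>

lemma value_dist_return:
  assumes "0 \<le> c"
  shows "value_dist (return borel c)"
  unfolding value_dist_def
proof
  interpret prob_space "return borel c" by (rule prob_space_return) simp
  show "real_distribution (return borel c)" by standard auto
  show "AE v in return borel c. 0 \<le> v" using assms by (subst AE_return) auto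
qed

lemma SPA_cong: "(\<And>i. i < m \<Longrightarrow> F i = F' i) \<Longrightarrow> SPA m F = SPA m F'"
  unfolding SPA_def by (subst PiM_cong[of "{..<m}" "{..<m}" F F']) auto

lemma BOM_cong: "(\<And>i. i < n \<Longrightarrow> F i = F' i) \<Longrightarrow> BOM n F = BOM n F'"
  unfolding BOM_def by (subst PiM_cong[of "{..<n}" "{..<n}" F F']) auto

lemma approx_const_quasi_regular: "approx_const quasi_regular 0.3817"
  unfolding approx_const_def
proof (intro conjI allI impI)
  fix n :: nat and F :: "nat \<Rightarrow> real measure"
  assume n: "1 \<le> n" and F: "\<forall>i<n. value_dist (F i) \<and> quasi_regular (F i)"
  \<comment> \<open>The lemmas above ask for distributions at every index, so indices from
    \<open>n\<close> on are filled with the point mass at 0.\<close>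
  define F' where "F' = (\<lambda>i. if i < n then F i else return borel 0)"
  have vd: "value_dist (F' i)" for i using F value_dist_return[of 0] by (simp add: F'_def)
  have qr: "quasi_regular (F' i)" if "i < n" for i using F that by (simp add: F'_def)
  have B: "BOM n F = BOM n F'" by (intro BOM_cong) (simp add: F'_def)
  have S: "SPA (Suc n) (F(n := F j)) = SPA (Suc n) (F'(n := F' j))" if "j < n" for j
    using that by (intro SPA_cong) (auto simp: F'_def)
  have le: "SPA (Suc n) (F'(n := F' j)) \<le> SPA_dup1 n F" if "j < n" for j
    using that unfolding SPA_dup1_def S[OF that, symmetric] by (intro Max_ge) auto
  have key: "ennreal 0.3817 * BOM n F \<le> ennreal s" if s: "0 < s" "SPA_dup1 n F \<le> ennreal s" for s
  proof -
    have "BOM n F \<le> ennreal (2.615 * s)"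
      unfolding B using le s by (intro BOM_le_of_SPA_dup_le vd qr) (auto intro: order_trans)
    then have "ennreal 0.3817 * BOM n F \<le> ennreal 0.3817 * ennreal (2.615 * s)"
      by (rule mult_left_mono) simp
    \<comment> \<open>Here \<open>0.3817 * 2.615 < 1\<close>.\<close>
    also have "\<dots> \<le> ennreal s"
      using s by (subst ennreal_mult[symmetric]) (auto intro!: ennreal_leI)
    finally show ?thesis .
  qed
  show "ennreal 0.3817 * BOM n F \<le> SPA_dup1 n F"
  proof (cases "SPA_dup1 n F")
    case (real \<sigma>)
    show ?thesis
    \<comment> \<open>\<open>key\<close> asks for a positive bound; passing to
      \<open>\<sigma> + e\<close> also settles auctions with revenue 0.\<close>
    proof (rule ennreal_le_epsilon)
      fix e :: real assume "0 < e"
      then show "ennreal 0.3817 * BOM n F \<le> SPA_dup1 n F + ennreal e"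
        using key[of "\<sigma> + e"] real by (simp add: ennreal_leI)
    qed
  qed simp
qed simp

section \<open>Regular distributions\<close>

lemma cdf_neg_eq_0:
  assumes "value_dist D" "v < 0"
  shows "cdf D v = 0"
proof -
  interpret real_distribution D using assms by (simp add: value_dist_def)
  have "AE u in D. u \<notin> {..v}"
    using assms by (auto simp: value_dist_def elim: eventually_mono)
  then have "{..v} \<in> null_sets D" by (subst AE_iff_null_sets) auto
  then show ?thesis by (simp add: cdf_def measure_def null_setsD1)
qed

lemma bdd_above_cdf_le:
  assumes "real_distribution D" "c < 1"
  shows "bdd_above {v. cdf D v \<le> c}"
proof -
  interpret real_distribution D by fact
  have "\<forall>\<^sub>F v in at_top. c < cdf D v"
    using cdf_lim_at_top_prob assms(2) by (rule order_tendstoD)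
  then obtain u where u: "c < cdf D u" by (meson eventually_happens trivial_limit_at_top_linorder)
  have "v \<le> u" if "cdf D v \<le> c" for v
    using u that cdf_nondecreasing[of u v] by linarith
  then show ?thesis by (intro bdd_aboveI[of _ u]) auto
qed

text \<open>Put \<open>q = 1 - F w\<close> and \<open>q' = 1 - F v\<close>. Concavity keeps the
  revenue curve above its chord from \<open>q\<close> to 1, whose right end is nonnegative, so at
  \<open>r\<close> between \<open>q'\<close> and 1 it is at least
  \<open>(1 - r) / (1 - q) * q * w\<close>. It is also at most \<open>r * v\<close>; letting
  \<open>r\<close> tend to \<open>q'\<close> gives the claim.\<close>

lemma regular_imp_quasi_regular:
  assumes vd: "value_dist D" and reg: "regular D"
  shows "quasi_regular D"
  unfolding quasi_regular_def
proof (rule mono_onI)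
  fix v w assume vw: "v \<in> {v. 0 < cdf D v}" "w \<in> {v. 0 < cdf D v}" "v \<le> w"
  have rd: "real_distribution D" using vd by (simp add: value_dist_def)
  note bounds = real_distribution_cdf_bounds[OF rd]
  have v: "0 \<le> v" using cdf_neg_eq_0[OF vd, of v] vw by (cases "v < 0") auto
  show "- v * ((1 - cdf D v) / cdf D v) \<le> - w * ((1 - cdf D w) / cdf D w)"
  proof (cases "cdf D w = 1")
    case True
    then show ?thesis using v bounds[of v] by simp
  next
    case False
    define q where "q = 1 - cdf D w"
    define q' where "q' = 1 - cdf D v"
    have q: "0 < q" "q < 1" "q \<le> q'" "q' < 1"
      using False bounds[of w] vw real_distribution_cdf_mono[OF rd vw(3)] by (auto simp: q_def q'_def)
    have Rq: "q * w \<le> revenue_curve D q"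
      unfolding revenue_curve_def using q
      by (intro mult_left_mono cSup_upper bdd_above_cdf_le[OF rd]) (auto simp: q_def)
    have R1: "0 \<le> revenue_curve D 1"
    proof -
      have "z \<le> Sup {v. cdf D v \<le> 0}" if "z < 0" for z
        using that cdf_neg_eq_0[OF vd that] by (intro cSup_upper bdd_above_cdf_le[OF rd]) auto
      then have "0 \<le> Sup {v. cdf D v \<le> 0}" by (rule dense_le)
      then show ?thesis by (simp add: revenue_curve_def)
    qed
    \<comment> \<open>At \<open>r = q'\<close> the set could reach beyond \<open>v\<close>, if the
      distribution function is flat to the right of \<open>v\<close>; hence \<open>r > q'\<close>
      and a limit afterwards.\<close>
    have R_le: "revenue_curve D r \<le> r * v" if "q' < r" "r < 1" for r
    proof -
      have "Sup {u. cdf D u \<le> 1 - r} \<le> v"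
      proof (rule cSup_least)
        have "-1 \<in> {u. cdf D u \<le> 1 - r}" using cdf_neg_eq_0[OF vd, of "-1"] that by simp
        then show "{u. cdf D u \<le> 1 - r} \<noteq> {}" by blast
        fix u assume "u \<in> {u. cdf D u \<le> 1 - r}"
        then have "cdf D u < cdf D v" using that by (simp add: q'_def)
        then show "u \<le> v" using real_distribution_cdf_mono[OF rd, of v u] by linarith
      qed
      then show ?thesis unfolding revenue_curve_def using that q by (intro mult_left_mono) auto
    qed
    have chord: "(1 - r) * (q * w) \<le> r * v * (1 - q)" if r: "q' < r" "r < 1" for r
    proof -
      define t where "t = (r - q) / (1 - q)"
      have t0: "t * (1 - q) = r - q" using q by (simp add: t_def)
      have t: "0 \<le> t" "t \<le> 1" using r q by (auto simp: t_def)
      have t': "(1 - t) * q + t * 1 = r" "(1 - t) * (1 - q) = 1 - r"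
        using t0 by (auto simp: algebra_simps)
      have "(1 - t) * (q * w) \<le> (1 - t) * revenue_curve D q + t * revenue_curve D 1"
        using Rq R1 t by (intro add_increasing2 mult_left_mono) auto
      also have "\<dots> \<le> revenue_curve D ((1 - t) *\<^sub>R q + t *\<^sub>R 1)"
        using reg q t unfolding regular_def by (intro concave_onD) auto
      also have "\<dots> \<le> r * v" using R_le[OF r] t' by simp
      finally have "(1 - q) * ((1 - t) * (q * w)) \<le> (1 - q) * (r * v)"
        using q by (intro mult_left_mono) auto
      then show ?thesis using t'(2) by (metis mult.assoc mult.commute)
    qed
    have lim: "((\<lambda>r. r * v * (1 - q) - (1 - r) * (q * w)) \<longlongrightarrow> q' * v * (1 - q) - (1 - q') * (q * w)) (at_right q')"
      by (intro tendsto_intros)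
    have "0 \<le> q' * v * (1 - q) - (1 - q') * (q * w)"
    proof (rule tendsto_lowerbound[OF lim])
      show "\<forall>\<^sub>F r in at_right q'. 0 \<le> r * v * (1 - q) - (1 - r) * (q * w)"
        using eventually_at_right_real[OF q(4)] by eventually_elim (use chord in fastforce)
    qed simp
    then have "cdf D v * (w * (1 - cdf D w)) \<le> v * (1 - cdf D v) * cdf D w"
      by (simp add: q_def q'_def algebra_simps)
    then have "w * (1 - cdf D w) / cdf D w \<le> v * (1 - cdf D v) / cdf D v"
      using vw by (simp add: field_simps)
    then show ?thesis by simp
  qed
qed

section \<open>Point masses and equal-revenue distributions\<close>

lemma regular_of_affine_revenue:
  assumes "\<And>q. q \<in> {0<..1} \<Longrightarrow> revenue_curve D q = c * q + d"
  shows "regular D"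
  unfolding regular_def concave_on_iff
proof (intro conjI ballI allI impI)
  fix x y u v :: real assume *: "x \<in> {0<..1}" "y \<in> {0<..1}" "0 \<le> u" "0 \<le> v" "u + v = 1"
  have "u *\<^sub>R x + v *\<^sub>R y \<in> {0<..1}"
    using * by (intro convexD) auto
  moreover have "u * (c * x + d) + v * (c * y + d) = c * (u * x + v * y) + (u + v) * d"
    by (simp add: algebra_simps)
  ultimately show "u * revenue_curve D x + v * revenue_curve D y \<le> revenue_curve D (u *\<^sub>R x + v *\<^sub>R y)"
    using * by (simp add: assms)
qed simp

lemma cdf_return: "cdf (return borel c) v = (if c \<le> v then 1 else 0)"
  by (simp add: cdf_def measure_return indicator_def)

lemma regular_return:
  assumes "0 \<le> c"
  shows "regular (return borel c)"
proof -
  have R: "revenue_curve (return borel c) q = q * c" if "q \<in> {0<..1}" for q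
  proof -
    have "{v. cdf (return borel c) v \<le> 1 - q} = {..<c}" using that by (auto simp: cdf_return)
    then show ?thesis by (simp add: revenue_curve_def)
  qed
  then show ?thesis by (intro regular_of_affine_revenue[where c = c and d = 0]) simp
qed

text \<open>For \<open>v > 0\<close> the quantity \<open>v * (1 - F v) / F v\<close> is constantly
  \<open>a\<close>, the extreme case of quasi-regularity. The revenue curve is affine, and the
  posted-price revenue \<open>v * a / (v + a)\<close> approaches \<open>a\<close> only as the price
  grows.\<close>

definition equal_revenue :: "real \<Rightarrow> real measure" where
  "equal_revenue a = interval_measure (\<lambda>v. if v < 0 then 0 else v / (v + a))"

context
  fixes a :: real
  assumes a: "0 < a"
begin

lemma equal_revenue_real_distribution: "real_distribution (equal_revenue a)"
  and cdf_equal_revenue: "cdf (equal_revenue a) = (\<lambda>v. if v < 0 then 0 else v / (v + a))"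
proof -
  let ?F = "\<lambda>v. if v < 0 then 0 else v / (v + a)"
  have mono: "?F x \<le> ?F y" if "x \<le> y" for x y
  proof (cases "x < 0")
    case False
    then have "a / (y + a) \<le> a / (x + a)" using that a by (intro frac_le) auto
    moreover have "z / (z + a) = 1 - a / (z + a)" if "0 \<le> z" for z using that a by (simp add: field_simps)
    ultimately show ?thesis using that False by simp
  qed (use a in auto)
  have eq: "?F v = max 0 v / (max 0 v + a)" for v using a by auto
  have "isCont (\<lambda>v. max 0 v / (max 0 v + a)) x" for x
    using a by (intro continuous_intros) (auto simp: max_def)
  then have cont: "continuous (at_right x) ?F" for x
    unfolding eq by (rule continuous_at_imp_continuous_at_within)
  have bot: "(?F \<longlongrightarrow> 0) at_bot"
  proof (rule tendsto_eventually)
    show "\<forall>\<^sub>F v in at_bot. ?F v = 0"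
      using eventually_gt_at_bot[of 0] by eventually_elim simp
  qed
  have top: "(?F \<longlongrightarrow> 1) at_top"
  proof -
    have "LIM v at_top. v + a :> at_top"
      by (subst add.commute) (rule filterlim_tendsto_add_at_top[OF tendsto_const filterlim_ident])
    then have "((\<lambda>v. 1 - a / (v + a)) \<longlongrightarrow> 1 - 0) at_top"
      by (intro tendsto_intros real_tendsto_divide_at_top[OF tendsto_const])
    moreover have "\<forall>\<^sub>F v in at_top. 1 - a / (v + a) = ?F v"
      using eventually_gt_at_top[of 0] by eventually_elim (use a in \<open>simp add: field_simps\<close>)
    ultimately show ?thesis using Lim_transform_eventually by fastforce
  qed
  show "real_distribution (equal_revenue a)"
    unfolding equal_revenue_def using mono cont bot top by (intro real_distribution_interval_measure)
  show "cdf (equal_revenue a) = ?F"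
    unfolding equal_revenue_def using mono cont bot by (intro cdf_interval_measure)
qed

lemma value_dist_equal_revenue: "value_dist (equal_revenue a)"
  unfolding value_dist_def
proof
  show rd: "real_distribution (equal_revenue a)" by (rule equal_revenue_real_distribution)
  interpret real_distribution "equal_revenue a" by (rule rd)
  have "measure (equal_revenue a) {..0} = 0"
    using cdf_equal_revenue by (simp add: cdf_def fun_eq_iff)
  then have "AE v in equal_revenue a. v \<notin> {..0}"
    by (subst AE_iff_null_sets[symmetric]) (auto simp: emeasure_eq_measure)
  then show "AE v in equal_revenue a. 0 \<le> v" by eventually_elim auto
qed

lemma regular_equal_revenue: "regular (equal_revenue a)"
proof -
  have R: "revenue_curve (equal_revenue a) q = a * (1 - q)" if q: "q \<in> {0<..1}" for q
  proof -
    have "cdf (equal_revenue a) v \<le> 1 - q \<longleftrightarrow> v \<le> a * (1 - q) / q" for v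
    proof (cases "v < 0")
      case True
      have "0 \<le> a * (1 - q) / q" using q a by simp
      with True q show ?thesis by (simp add: cdf_equal_revenue)
    next
      case False
      then have "v / (v + a) \<le> 1 - q \<longleftrightarrow> v \<le> (1 - q) * (v + a)"
        using a by (subst pos_divide_le_eq) auto
      also have "\<dots> \<longleftrightarrow> v \<le> a * (1 - q) / q"
        using q by (subst pos_le_divide_eq) (auto simp: algebra_simps)
      finally show ?thesis using False by (simp add: cdf_equal_revenue)
    qed
    then have "{v. cdf (equal_revenue a) v \<le> 1 - q} = {..a * (1 - q) / q}" by auto
    then show ?thesis using q by (simp add: revenue_curve_def)
  qed
  then show ?thesis by (intro regular_of_affine_revenue[where c = "- a" and d = a]) (simp add: algebra_simps)
qed

end

section \<open>Bounds on the optimal constants\<close>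

definition hard_instance :: "real \<Rightarrow> nat \<Rightarrow> real measure" where
  "hard_instance a i = (if i = 1 then equal_revenue a else return borel 1)"

lemma value_dist_hard_instance: "0 < a \<Longrightarrow> value_dist (hard_instance a i)"
  by (simp add: hard_instance_def value_dist_equal_revenue value_dist_return)

lemma regular_hard_instance: "0 < a \<Longrightarrow> regular (hard_instance a i)"
  by (simp add: hard_instance_def regular_equal_revenue regular_return)

lemma at_most_one_three:
  "at_most_one {..<3::nat} G = G 2 * (G 1 + (1 - G 1) * G 0) + (1 - G 2) * (G 1 * G 0)"
proof -
  have "{..<3} = insert 2 (insert 1 {0::nat})" by auto
  moreover have "at_most_one {0} G = 1" by (simp add: at_most_one_def)
  ultimately show ?thesis by (simp add: at_most_one_insert)
qed

lemma SPA_hard_instance: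
  assumes "0 < a"
  shows "SPA (Suc 2) ((hard_instance a)(2 := hard_instance a j))
    = (\<integral>\<^sup>+ t. indicator {0<..} t * ennreal (1 - at_most_one {..<Suc 2}
         (\<lambda>i. cdf (((hard_instance a)(2 := hard_instance a j)) i) t)) \<partial>lborel)"
  using value_dist_hard_instance[OF assms]
  by (intro SPA_eq_integral) (auto simp: value_dist_def)

lemma SPA_hard_instance_0:
  assumes "0 < a"
  shows "SPA (Suc 2) ((hard_instance a)(2 := hard_instance a 0)) \<le> 1"
proof -
  have "SPA (Suc 2) ((hard_instance a)(2 := hard_instance a 0)) \<le> (\<integral>\<^sup>+ t. indicator {0<..<1::real} t \<partial>lborel)"
    unfolding SPA_hard_instance[OF assms]
    by (intro nn_integral_mono)
       (auto simp: at_most_one_three hard_instance_def cdf_return indicator_def)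
  then show ?thesis by simp
qed

text \<open>Below level 1 the constant buyer exceeds \<open>t\<close>, so one high copy of the other
  buyer is enough; from level 1 on both copies must exceed \<open>t\<close>. \<open>?f\<close> and
  \<open>?g\<close> are these two probabilities.\<close>

lemma SPA_hard_instance_1:
  assumes a: "0 < a"
  shows "SPA (Suc 2) ((hard_instance a)(2 := hard_instance a 1))
           \<le> ennreal (2 * a * ln ((1 + a) / a) + 2 * a\<^sup>2 / (1 + a) - a)"
proof -
  let ?f = "\<lambda>t. 1 - (t / (t + a))\<^sup>2" and ?g = "\<lambda>t. (a / (t + a))\<^sup>2"
  have "SPA (Suc 2) ((hard_instance a)(2 := hard_instance a 1))
      \<le> (\<integral>\<^sup>+ t. ennreal (?f t) * indicator {0..1} t + ennreal (?g t) * indicator {1..} t \<partial>lborel)"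
    unfolding SPA_hard_instance[OF a]
  proof (rule nn_integral_mono)
    fix t
    let ?T = "1 - at_most_one {..<Suc 2} (\<lambda>i. cdf (((hard_instance a)(2 := hard_instance a 1)) i) t)"
    consider "t \<le> 0" | "0 < t" "t < 1" | "1 \<le> t" by linarith
    then show "indicator {0<..} t * ennreal ?T
        \<le> ennreal (?f t) * indicator {0..1} t + ennreal (?g t) * indicator {1..} t"
    proof cases
      case 2
      then have "?T = ?f t"
        by (simp add: at_most_one_three hard_instance_def cdf_return cdf_equal_revenue[OF a] power2_eq_square)
      with 2 show ?thesis by simp
    next
      case 3
      then have "?T = (1 - t / (t + a))\<^sup>2"
        by (simp add: at_most_one_three hard_instance_def cdf_return cdf_equal_revenue[OF a]
            power2_eq_square algebra_simps)
      also have "1 - t / (t + a) = a / (t + a)" using 3 a by (simp add: field_simps)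
      finally show ?thesis using 3 by (simp add: add_increasing)
    qed simp
  qed
  also have "\<dots> = (\<integral>\<^sup>+ t. ennreal (?f t) * indicator {0..1} t \<partial>lborel)
      + (\<integral>\<^sup>+ t. ennreal (?g t) * indicator {1..} t \<partial>lborel)"
    by (intro nn_integral_add) auto
  also have "(\<integral>\<^sup>+ t. ennreal (?f t) * indicator {0..1} t \<partial>lborel)
      = ennreal ((2 * a * ln (1 + a) + a\<^sup>2 / (1 + a)) - (2 * a * ln (0 + a) + a\<^sup>2 / (0 + a)))"
  proof (rule nn_integral_FTC_Icc)
    fix t :: real assume "t \<in> {0..1}"
    then have t: "0 \<le> t" "0 < t + a" using a by auto
    have "((\<lambda>t. 2 * a * ln (t + a) + a\<^sup>2 / (t + a)) has_real_derivative
        2 * a / (t + a) - a\<^sup>2 / (t + a)\<^sup>2) (at t)"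
      using t by (auto intro!: derivative_eq_intros simp: power2_eq_square)
    moreover have "2 * a / (t + a) - a\<^sup>2 / (t + a)\<^sup>2 = ?f t"
      using t by (simp add: power2_eq_square divide_simps) (simp add: algebra_simps)
    ultimately show "((\<lambda>t. 2 * a * ln (t + a) + a\<^sup>2 / (t + a)) has_real_derivative ?f t) (at t)" by simp
    have "(t / (t + a))\<^sup>2 \<le> 1" using t a by (intro power_le_one) auto
    then show "0 \<le> ?f t" by simp
  qed auto
  also have "(\<integral>\<^sup>+ t. ennreal (?g t) * indicator {1..} t \<partial>lborel) = ennreal (0 - (- a\<^sup>2 / (1 + a)))"
  proof (rule nn_integral_FTC_atLeast)
    fix t :: real assume "1 \<le> t"
    then have t: "0 < t + a" using a by auto
    show "((\<lambda>t. - a\<^sup>2 / (t + a)) has_real_derivative ?g t) (at t)"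
      using t by (auto intro!: derivative_eq_intros simp: power2_eq_square)
  next
    have "LIM t at_top. t + a :> at_top"
      by (subst add.commute) (rule filterlim_tendsto_add_at_top[OF tendsto_const filterlim_ident])
    then show "((\<lambda>t. - a\<^sup>2 / (t + a)) \<longlongrightarrow> 0) at_top"
      by (rule real_tendsto_divide_at_top[OF tendsto_const])
  qed auto
  also have "ennreal ((2 * a * ln (1 + a) + a\<^sup>2 / (1 + a)) - (2 * a * ln (0 + a) + a\<^sup>2 / (0 + a)))
      + ennreal (0 - (- a\<^sup>2 / (1 + a)))
    = ennreal (2 * a * ln ((1 + a) / a) + 2 * a\<^sup>2 / (1 + a) - a)"
  proof -
    let ?A = "(2 * a * ln (1 + a) + a\<^sup>2 / (1 + a)) - (2 * a * ln (0 + a) + a\<^sup>2 / (0 + a))"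
    have A: "?A = 2 * a * ln ((1 + a) / a) + a\<^sup>2 / (1 + a) - a"
      using a by (simp add: ln_div power2_eq_square algebra_simps)
    \<comment> \<open>Merging the two \<open>ennreal\<close> terms requires
      \<open>0 \<le> ?A\<close>, which follows from
      \<open>ln ((1 + a) / a) \<ge> 1 / (1 + a)\<close>.\<close>
    have "ln (a / (1 + a)) \<le> a / (1 + a) - 1"
      using a by (intro ln_le_minus_one) auto
    also have "\<dots> = - (1 / (1 + a))" using a by (simp add: field_simps)
    finally have "1 / (1 + a) \<le> ln ((1 + a) / a)" using a by (simp add: ln_div)
    then have "2 * a * (1 / (1 + a)) \<le> 2 * a * ln ((1 + a) / a)"
      using a by (intro mult_left_mono) auto
    moreover have "2 * a * (1 / (1 + a)) + a\<^sup>2 / (1 + a) - a = a / (1 + a)"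
      using a by (simp add: power2_eq_square divide_simps) (simp add: algebra_simps)
    moreover have "0 \<le> a / (1 + a)" using a by simp
    ultimately have "0 \<le> ?A" unfolding A by linarith
    then have "ennreal ?A + ennreal (0 - (- a\<^sup>2 / (1 + a))) = ennreal (?A + (0 - (- a\<^sup>2 / (1 + a))))"
      using a by (intro ennreal_plus[symmetric]) auto
    also have "?A + (0 - (- a\<^sup>2 / (1 + a))) = 2 * a * ln ((1 + a) / a) + 2 * a\<^sup>2 / (1 + a) - a"
      unfolding A by (simp add: algebra_simps)
    finally show ?thesis .
  qed
  finally show ?thesis .
qed

lemma SPA_dup1_hard_instance: "SPA_dup1 2 (hard_instance 0.571) \<le> 1"
proof -
  \<comment> \<open>The revenue bound stays below 1 for logarithms up to about 1.01219. The true
    value is about 1.01208, and eight terms of the exponential series separate the two.\<close>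
  have "ln ((1 + 0.571) / 0.571) \<le> (1.01219 :: real)"
  proof -
    have "(1 + 0.571) / 0.571 \<le> (\<Sum>k<8. (1.01219::real) ^ k /\<^sub>R fact k)"
      by (simp add: eval_nat_numeral)
    also have "\<dots> \<le> exp 1.01219"
      using exp_converges[of "1.01219::real"]
      by (subst sums_unique[OF exp_converges]) (intro sum_le_suminf, auto simp: sums_iff)
    finally show ?thesis by (subst (asm) ln_le_cancel_iff[symmetric]) auto
  qed
  then have "2 * 0.571 * ln ((1 + 0.571) / 0.571) + 2 * 0.571\<^sup>2 / (1 + 0.571) - 0.571 \<le> (1::real)"
    by (simp add: power2_eq_square)
  then have "SPA (Suc 2) ((hard_instance 0.571)(2 := hard_instance 0.571 1)) \<le> ennreal 1"
    by (intro order_trans[OF SPA_hard_instance_1] ennreal_leI) auto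
  moreover have "{..<2::nat} = {0, 1}" by auto
  ultimately show ?thesis
    using SPA_hard_instance_0[of "0.571"] by (simp add: SPA_dup1_def)
qed

text \<open>Offer price \<open>c\<close> to buyer 1 and, on refusal, price 1 to buyer 0. The revenue
  \<open>c * a / (c + a) + c / (c + a)\<close> tends to \<open>1 + a\<close> as \<open>c\<close>
  grows.\<close>

lemma BOM_hard_instance_ge:
  assumes a: "0 < a" and c: "0 < c"
  shows "ennreal ((1 + a) * c / (c + a)) \<le> BOM 2 (hard_instance a)"
proof -
  define x where "x = (\<lambda>(i::nat) (v::nat \<Rightarrow> real).
    if i = 1 then (if c < v 1 then 1 else 0) else (if v 1 \<le> c \<and> 1 \<le> v 0 then 1 else 0) :: real)"
  define p where "p = (\<lambda>i v. if i = 1 then c * x 1 v else x i v)"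
  let ?P = "PiM {..<2} (hard_instance a)"
  have vd: "value_dist (hard_instance a i)" for i by (rule value_dist_hard_instance[OF a])
  then have rd: "real_distribution (hard_instance a i)" for i by (simp add: value_dist_def)
  interpret finite_product_prob_space "hard_instance a" "{..<2}"
    by (rule finite_product_prob_space_real_distribution[OF rd]) simp
  have two: "{..<2::nat} = {0, 1}" by auto
  have [measurable]: "(\<lambda>v. v 0) \<in> borel_measurable (PiM {..<2::nat} (\<lambda>_. borel :: real measure))"
    "(\<lambda>v. v 1) \<in> borel_measurable (PiM {..<2::nat} (\<lambda>_. borel :: real measure))"
    by (auto intro!: measurable_component_singleton)
  have fe: "feasible 2 x p"
    unfolding feasible_def
  proof (intro conjI allI impI ballI)
    fix i :: nat assume "i < 2"
    show "x i \<in> borel_measurable (PiM {..<2} (\<lambda>_. borel))"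
      "p i \<in> borel_measurable (PiM {..<2} (\<lambda>_. borel))"
      unfolding x_def p_def by (cases "i = 1"; simp)+
  qed (use c in \<open>auto simp: x_def p_def two\<close>)
  have ic: "DSIC 2 x p"
    unfolding DSIC_def by (auto simp: x_def p_def less_2_cases_iff)
  have ir: "IR 2 x p"
    unfolding IR_def by (auto simp: x_def p_def less_2_cases_iff)
  define E0 where "E0 = PiE {..<2::nat} (\<lambda>i. if i = 1 then {..c} else {1..})"
  define E1 where "E1 = PiE {..<2::nat} (\<lambda>i. if i = 1 then {c<..} else UNIV)"
  have sets: "sets (hard_instance a i) = sets borel" for i using rd by (simp add: sets_real_distribution)
  have space: "space (hard_instance a i) = UNIV" for i using rd by (rule real_distribution.space_eq_univ)
  have E: "E0 \<in> sets ?P" "E1 \<in> sets ?P"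
    unfolding E0_def E1_def by (auto intro!: sets_PiM_I_finite simp: sets)
  have F1: "measure (hard_instance a 1) {..c} = c / (c + a)"
    using cdf_equal_revenue[OF a] c by (simp add: hard_instance_def cdf_def fun_eq_iff)
  have F1': "measure (hard_instance a 1) {c<..} = a / (c + a)"
  proof -
    have "{c<..} = space (hard_instance a 1) - {..c}" by (auto simp: space)
    then have "measure (hard_instance a 1) {c<..} = 1 - c / (c + a)"
      using M.prob_compl[of "{..c}" 1] by (simp add: sets F1[simplified])
    then show ?thesis using a c by (simp add: field_simps)
  qed
  have F0: "measure (hard_instance a 0) {1..} = 1"
    by (simp add: hard_instance_def measure_return)
  have F0': "measure (hard_instance a 0) UNIV = 1"
    using M.prob_space[of 0] by (simp add: space)
  have "prob E0 = c / (c + a)"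
    unfolding E0_def by (subst prob_times) (auto simp: sets two F0 F1 F1[simplified])
  then have PE0: "emeasure ?P E0 = ennreal (c / (c + a))" by (simp add: emeasure_eq_measure)
  have "prob E1 = a / (c + a)"
    unfolding E1_def by (subst prob_times) (auto simp: sets two F0' F1' F1'[simplified])
  then have PE1: "emeasure ?P E1 = ennreal (a / (c + a))" by (simp add: emeasure_eq_measure)
  have "ennreal ((1 + a) * c / (c + a)) = ennreal (c / (c + a)) + ennreal c * ennreal (a / (c + a))"
    using a c by (simp add: ennreal_mult[symmetric] ennreal_plus[symmetric] algebra_simps
        add_divide_distrib[symmetric] del: ennreal_plus)
  also have "\<dots> = (\<integral>\<^sup>+ v. indicator E0 v + ennreal c * indicator E1 v \<partial>?P)"
    using E by (subst nn_integral_add) (auto simp: nn_integral_cmult PE0 PE1)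
  also have "\<dots> \<le> (\<integral>\<^sup>+ v. ennreal (\<Sum>i<2. p i v) \<partial>?P)"
  proof (rule nn_integral_mono)
    fix v
    show "indicator E0 v + ennreal c * indicator E1 v \<le> ennreal (\<Sum>i<2. p i v)"
      using c by (auto simp: E0_def E1_def p_def x_def two indicator_def PiE_iff)
  qed
  also have "\<dots> \<le> BOM 2 (hard_instance a)"
    unfolding BOM_def using fe ic ir by (intro SUP_upper2[of "(x, p)"]) auto
  finally show ?thesis .
qed

lemma approx_const_le:
  assumes "approx_const P c" "\<And>i. P (hard_instance 0.571 i)"
  shows "c \<le> 1 / 1.571"
proof (rule ccontr)
  define a :: real where "a = 0.571"
  then have a: "a = 0.571" "0 < a" by auto
  assume "\<not> c \<le> 1 / 1.571"
  then have c: "1 < c * (1 + a)" "0 < c" by (auto simp: a(1) field_simps)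
  \<comment> \<open>The price \<open>d\<close> is large enough that
    \<open>d * (c * (1 + a) - 1) = a + 1\<close>, whereas the guarantee \<open>c\<close> would force
    this product to be at most \<open>a\<close>.\<close>
  define d where "d = (a + 1) / (c * (1 + a) - 1)"
  have d: "0 < d" unfolding d_def using c(1) a(2) by (intro divide_pos_pos) auto
  have "ennreal c * ennreal ((1 + a) * d / (d + a)) \<le> ennreal c * BOM 2 (hard_instance a)"
    using a d by (intro mult_left_mono BOM_hard_instance_ge) auto
  also have "\<dots> \<le> SPA_dup1 2 (hard_instance a)"
    using assms value_dist_hard_instance[OF a(2)] unfolding approx_const_def a(1)[symmetric] by auto
  also have "\<dots> \<le> 1" unfolding a(1) by (rule SPA_dup1_hard_instance)
  finally have "c * ((1 + a) * d / (d + a)) \<le> 1"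
    using c d a(2) by (simp add: ennreal_mult[symmetric])
  then have "c * (1 + a) * d \<le> d + a" using d a(2) by (simp add: field_simps)
  then have "d * (c * (1 + a) - 1) \<le> a" by (simp add: algebra_simps)
  moreover have "d * (c * (1 + a) - 1) = a + 1" using c(1) by (simp add: d_def)
  ultimately show False by simp
qed

text \<open>On each instance the guarantee is a closed condition on \<open>c\<close>, so the
  supremum of all guarantees is one. If \<open>BOM\<close> is infinite, the positive
  \<open>c0\<close> shows that the auction revenue is infinite too.\<close>

lemma largest_approx_const_exists:
  assumes c0: "approx_const P c0" "0 < c0" and u: "\<And>c. approx_const P c \<Longrightarrow> c \<le> u"
  shows "\<exists>C. largest_approx_const P C"
proof -
  define C where "C = Sup {c. approx_const P c}"
  have bdd: "bdd_above {c. approx_const P c}" using u by (intro bdd_aboveI[of _ u]) auto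
  have upper: "c \<le> C" if "approx_const P c" for c
    unfolding C_def using that bdd by (intro cSup_upper) auto
  have "approx_const P C"
    unfolding approx_const_def
  proof (intro conjI allI impI)
    show "0 \<le> C" using upper[OF c0(1)] c0(2) by simp
    fix n :: nat and F assume n: "1 \<le> n" and F: "\<forall>i<n. value_dist (F i) \<and> P (F i)"
    have le: "ennreal c * BOM n F \<le> SPA_dup1 n F" if "approx_const P c" for c
      using that n F unfolding approx_const_def by blast
    show "ennreal C * BOM n F \<le> SPA_dup1 n F"
    proof (cases "BOM n F")
      case top
      then show ?thesis using le[OF c0(1)] c0(2) by (simp add: ennreal_mult_top top_unique)
    next
      case (real b)
      show ?thesis
      proof (cases "SPA_dup1 n F")
        case (real \<sigma>)
        have "c * b \<le> \<sigma>" if "approx_const P c" for c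
          using le[OF that] that \<open>BOM n F = ennreal b\<close> \<open>0 \<le> b\<close> real
          by (simp add: ennreal_mult[symmetric] approx_const_def)
        then have "C * b \<le> \<sigma>"
        proof (cases "b = 0")
          case False
          then have "C \<le> \<sigma> / b"
            unfolding C_def using c0 \<open>\<And>c. approx_const P c \<Longrightarrow> c * b \<le> \<sigma>\<close> \<open>0 \<le> b\<close>
            by (intro cSup_least) (auto simp: pos_le_divide_eq)
          then show ?thesis using False \<open>0 \<le> b\<close> by (simp add: pos_le_divide_eq)
        qed (use real in simp)
        then show ?thesis
          using real \<open>BOM n F = ennreal b\<close> \<open>0 \<le> b\<close> \<open>0 \<le> C\<close> by (simp add: ennreal_mult[symmetric] ennreal_leI)
      qed simp
    qed
  qed
  then show ?thesis using upper by (auto simp: largest_approx_const_def)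
qed

theorem mainTheorem12:
  shows "\<exists>C_Qreg C_reg l_Qreg l_reg u.
           largest_approx_const quasi_regular C_Qreg \<and>
           largest_approx_const regular C_reg \<and>
           C_Qreg \<in> {l_Qreg..u} \<and> C_reg \<in> {l_reg..u} \<and>
           round4 l_Qreg = 0.2770 \<and> round4 l_reg = 0.3817 \<and> round4 u = 0.6365"
proof -
  have Q: "approx_const quasi_regular 0.3817" by (rule approx_const_quasi_regular)
  then have R: "approx_const regular 0.3817"
    unfolding approx_const_def using regular_imp_quasi_regular by blast
  have uR: "c \<le> 1 / 1.571" if "approx_const regular c" for c
    using that by (rule approx_const_le) (simp add: regular_hard_instance)
  have uQ: "c \<le> 1 / 1.571" if "approx_const quasi_regular c" for c
    using that by (rule approx_const_le)
      (simp add: regular_hard_instance regular_imp_quasi_regular value_dist_hard_instance)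
  obtain C_Q where CQ: "largest_approx_const quasi_regular C_Q"
    using largest_approx_const_exists[OF Q _ uQ] by auto
  obtain C_R where CR: "largest_approx_const regular C_R"
    using largest_approx_const_exists[OF R _ uR] by auto
  \<comment> \<open>The bound 0.3817 holds for both constants and is weakened to 0.2770 for the
    quasi-regular one. \<open>1 / 1.571\<close> is about 0.63654, slightly above the decimal 0.6365
    to which it rounds.\<close>
  have "C_Q \<in> {0.2770..1 / 1.571}" "C_R \<in> {0.3817..1 / 1.571}"
    using CQ CR Q R uQ uR by (force simp: largest_approx_const_def)+
  moreover have "round4 0.2770 = 0.2770" "round4 0.3817 = 0.3817" "round4 (1 / 1.571) = 0.6365"
    by (simp_all add: round4_def round_def)
  ultimately show ?thesis using CQ CR by blast
qed

end
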